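(* Let $n\ge2$ and $1\le k\le n$. In the algebra $\overline{3HT_n(\beta,\boldsymbol h)}$ the shifted multiplicative Dunkl elements $\mathfrak{D}_1,\dots,\mathfrak{D}_n$ satisfy $$\sum_{I\subset[1,n],\,|I|=k}\mathfrak{D}_I\prod_{\substack{i\notin I,\ j\in I\\ i<j}}\bigl(1+t\beta-t^2q_{ij}\bigr)=\sum_{1\le i_1<\cdots<i_k\le n}\ \prod_{a=1}^{k}(1+t\beta)^{n-k-i_a+a}\left(z_{i_a}(1+t\beta)^{i_a-a}+1+h_{i_a}\frac{(1+t\beta)^{i_a-a}-1}{\beta}\right),$$ where $\mathfrak{D}_I=\prod_{a\in I}\mathfrak{D}_a$.
   Context: Let $\beta,t$, $h_2,\dots,h_n$ and $q_{ij}=q_{ji}$ ($1\le i\neq j\le n$) be commuting central parameters, $h_1:=0$, and let the coefficient ring be $\mathbb{Z}[\beta,t,h_2,\dots,h_n,\{q_{ij}\}]$ with all elements $1+\beta t-t^2q_{ij}$ inverted. The algebra $\overline{3HT_n(\beta,\boldsymbol h)}$ is the associative algebra over this ring generated by $u_{ij}$ ($1\le i<j\le n$) and pairwise commuting elements $z_1,\dots,z_n$ subject to: - $u_{ij}u_{kl}=u_{kl}u_{ij}$ if $\{i,j\}\cap\{k,l\}=\varnothing$; - for $i<j<k$: $u_{ij}u_{jk}=u_{ik}u_{ij}+u_{jk}u_{ik}-\beta u_{ik}$ and $u_{jk}u_{ij}=u_{ij}u_{ik}+u_{ik}u_{jk}-\beta u_{ik}$; - $u_{ij}^2-\beta u_{ij}=q_{ij}$;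 - $z_iu_{kl}=u_{kl}z_i$ if $i\notin\{k,l\}$; - for $i<j$: $z_iu_{ij}=u_{ij}z_j+\beta z_i+h_j$ and $z_ju_{ij}=u_{ij}z_i-\beta z_i-h_j$. For $i<j$ put $h_{ij}=1+t\,u_{ij}$; it is invertible, with $h_{ij}^{-1}=(1+\beta t-t^2q_{ij})^{-1}(1+t\beta-tu_{ij})$. The shifted multiplicative Dunkl elements are $$\mathfrak{D}_i=h_{i-1,i}^{-1}h_{i-2,i}^{-1}\cdots h_{1,i}^{-1}\,(1+z_i)\,h_{i,n}h_{i,n-1}\cdots h_{i,i+1};$$ they commute pairwise. The fraction $\frac{(1+t\beta)^m-1}{\beta}$ denotes the polynomial $\sum_{r\ge1}\binom mr t^r\beta^{r-1}$. *)

theory Defs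
  imports "HOL-Library.Poly_Mapping" "HOL-Algebra.QuotRing"
begin

section \<open>Noncommutative integer polynomials\<close>

datatype 'g word = Word (letters: "'g list")

instantiation word :: (type) monoid_add
begin

definition "(0 :: 'a word) = Word []"
definition "v + w = Word (letters v @ letters w)"

instance
  by standard (simp_all add: zero_word_def plus_word_def)

end

text \<open>
  Words form the free monoid under concatenation, written additively, so the convolution
  product of \<^theory>\<open>HOL-Library.Poly_Mapping\<close> makes finitely supported functions
  from words to the integers the free associative unital ring on the letters.
\<close>

type_synonym 'g ncpoly = "'g word \<Rightarrow>\<^sub>0 int"

definition gvar :: "'g \<Rightarrow> 'g ncpoly"
  where "gvar g = Poly_Mapping.single (Word [g]) 1"

definition free_ring :: "'g set \<Rightarrow> 'g ncpoly ring"
  where "free_ring G =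
    \<lparr>carrier = {p. \<forall>w\<in>Poly_Mapping.keys p. set (letters w) \<subseteq> G},
     monoid.mult = (*), one = 1, ring.zero = 0, add = (+)\<rparr>"

lemma free_ring_simps [simp]:
  "x \<otimes>\<^bsub>free_ring G\<^esub> y = x * y" "\<one>\<^bsub>free_ring G\<^esub> = 1"
  "x \<oplus>\<^bsub>free_ring G\<^esub> y = x + y" "\<zero>\<^bsub>free_ring G\<^esub> = 0"
  by (simp_all add: free_ring_def)

lemma free_ring_carrier:
  "p \<in> carrier (free_ring G) \<longleftrightarrow> (\<forall>w\<in>Poly_Mapping.keys p. set (letters w) \<subseteq> G)"
  by (simp add: free_ring_def)

lemma free_ring_closed:
  "0 \<in> carrier (free_ring G)"
  "1 \<in> carrier (free_ring G)"
  "x \<in> carrier (free_ring G) \<Longrightarrow> y \<in> carrier (free_ring G) \<Longrightarrow> x + y \<in> carrier (free_ring G)"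
  "x \<in> carrier (free_ring G) \<Longrightarrow> - x \<in> carrier (free_ring G)"
  "x \<in> carrier (free_ring G) \<Longrightarrow> y \<in> carrier (free_ring G) \<Longrightarrow> x - y \<in> carrier (free_ring G)"
  "x \<in> carrier (free_ring G) \<Longrightarrow> y \<in> carrier (free_ring G) \<Longrightarrow> x * y \<in> carrier (free_ring G)"
  "g \<in> G \<Longrightarrow> gvar g \<in> carrier (free_ring G)"
proof -
  show add: "x + y \<in> carrier (free_ring G)"
    if "x \<in> carrier (free_ring G)" "y \<in> carrier (free_ring G)" for x y
    using that Poly_Mapping.keys_add[of x y] unfolding free_ring_carrier by blast
  show neg: "- x \<in> carrier (free_ring G)" if "x \<in> carrier (free_ring G)" for x
    using that unfolding free_ring_carrier by (simp add: in_keys_iff)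
  show "x - y \<in> carrier (free_ring G)"
    if "x \<in> carrier (free_ring G)" "y \<in> carrier (free_ring G)" for x y
    using add[OF that(1) neg[OF that(2)]] by simp
  show "x * y \<in> carrier (free_ring G)"
    if "x \<in> carrier (free_ring G)" "y \<in> carrier (free_ring G)" for x y
    unfolding free_ring_carrier
  proof
    fix w assume "w \<in> Poly_Mapping.keys (x * y)"
    then obtain a b where "w = a + b" "a \<in> Poly_Mapping.keys x" "b \<in> Poly_Mapping.keys y"
      using keys_mult[of x y] by blast
    then show "set (letters w) \<subseteq> G"
      using that by (auto simp: free_ring_carrier plus_word_def)
  qed
qed (auto simp: free_ring_carrier gvar_def zero_word_def split: if_splits)

lemma free_ring_ring: "ring (free_ring G)"
proof (rule ringI)
  show "abelian_group (free_ring G)"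
  proof (rule abelian_groupI)
    fix x assume "x \<in> carrier (free_ring G)"
    then show "\<exists>y\<in>carrier (free_ring G). y \<oplus>\<^bsub>free_ring G\<^esub> x = \<zero>\<^bsub>free_ring G\<^esub>"
      by (intro bexI[of _ "- x"]) (simp_all add: free_ring_closed)
  qed (simp_all add: free_ring_closed add.assoc add.commute)
  show "Group.monoid (free_ring G)"
    by (rule monoidI) (simp_all add: free_ring_closed mult.assoc)
qed (simp_all add: algebra_simps)


section \<open>The algebra by generators and relations\<close>

text \<open>
  The algebra is presented as a ring, the coefficients being adjoined as central generators.
  \<open>GQ i j\<close> with \<open>i < j\<close> stands for both \<open>q\<^sub>i\<^sub>j\<close> and \<open>q\<^sub>j\<^sub>i\<close>; the localisation of the coefficient
  ring is carried out by an inverse \<open>GE i j\<close> of \<open>1 + \<beta> t - t\<^sup>2 q\<^sub>i\<^sub>j\<close>.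
\<close>

datatype gen = GBeta | GT | GH nat | GQ nat nat | GE nat nat | GU nat nat | GZ nat

definition coeff_gens :: "nat \<Rightarrow> gen set"
  where "coeff_gens n = {GBeta, GT} \<union> {GH i | i. 2 \<le> i \<and> i \<le> n}
    \<union> {GQ i j | i j. 1 \<le> i \<and> i < j \<and> j \<le> n} \<union> {GE i j | i j. 1 \<le> i \<and> i < j \<and> j \<le> n}"

definition ht_gens :: "nat \<Rightarrow> gen set"
  where "ht_gens n = coeff_gens n
    \<union> {GU i j | i j. 1 \<le> i \<and> i < j \<and> j \<le> n} \<union> {GZ i | i. 1 \<le> i \<and> i \<le> n}"

definition hpar :: "nat \<Rightarrow> gen ncpoly"
  where "hpar i = (if i = 1 then 0 else gvar (GH i))"

abbreviation (input) "v\<beta> \<equiv> gvar GBeta"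
abbreviation (input) "vt \<equiv> gvar GT"
abbreviation (input) "vq i j \<equiv> gvar (GQ i j)"
abbreviation (input) "vu i j \<equiv> gvar (GU i j)"
abbreviation (input) "vz i \<equiv> gvar (GZ i)"

inductive ht_rel :: "nat \<Rightarrow> gen ncpoly \<Rightarrow> gen ncpoly \<Rightarrow> bool" for n
  where
    central: "c \<in> coeff_gens n \<Longrightarrow> g \<in> ht_gens n \<Longrightarrow> ht_rel n (gvar c * gvar g) (gvar g * gvar c)"
  | localisation: "1 \<le> i \<Longrightarrow> i < j \<Longrightarrow> j \<le> n \<Longrightarrow>
      ht_rel n ((1 + v\<beta> * vt - vt^2 * vq i j) * gvar (GE i j)) 1"
  | z_z: "i \<in> {1..n} \<Longrightarrow> j \<in> {1..n} \<Longrightarrow> ht_rel n (vz i * vz j) (vz j * vz i)"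
  | u_u: "1 \<le> i \<Longrightarrow> i < j \<Longrightarrow> j \<le> n \<Longrightarrow> 1 \<le> k \<Longrightarrow> k < l \<Longrightarrow> l \<le> n \<Longrightarrow> {i, j} \<inter> {k, l} = {} \<Longrightarrow>
      ht_rel n (vu i j * vu k l) (vu k l * vu i j)"
  | three_term1: "1 \<le> i \<Longrightarrow> i < j \<Longrightarrow> j < k \<Longrightarrow> k \<le> n \<Longrightarrow>
      ht_rel n (vu i j * vu j k) (vu i k * vu i j + vu j k * vu i k - v\<beta> * vu i k)"
  | three_term2: "1 \<le> i \<Longrightarrow> i < j \<Longrightarrow> j < k \<Longrightarrow> k \<le> n \<Longrightarrow>
      ht_rel n (vu j k * vu i j) (vu i j * vu i k + vu i k * vu j k - v\<beta> * vu i k)"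
  | quadratic: "1 \<le> i \<Longrightarrow> i < j \<Longrightarrow> j \<le> n \<Longrightarrow>
      ht_rel n ((vu i j)^2 - v\<beta> * vu i j) (vq i j)"
  | z_u: "i \<in> {1..n} \<Longrightarrow> 1 \<le> k \<Longrightarrow> k < l \<Longrightarrow> l \<le> n \<Longrightarrow> i \<notin> {k, l} \<Longrightarrow>
      ht_rel n (vz i * vu k l) (vu k l * vz i)"
  | z_u_left: "1 \<le> i \<Longrightarrow> i < j \<Longrightarrow> j \<le> n \<Longrightarrow>
      ht_rel n (vz i * vu i j) (vu i j * vz j + v\<beta> * vz i + hpar j)"
  | z_u_right: "1 \<le> i \<Longrightarrow> i < j \<Longrightarrow> j \<le> n \<Longrightarrow>
      ht_rel n (vz j * vu i j) (vu i j * vz i - v\<beta> * vz i - hpar j)"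

definition ht_ideal :: "nat \<Rightarrow> gen ncpoly set"
  where "ht_ideal n = Idl\<^bsub>free_ring (ht_gens n)\<^esub> {x - y | x y. ht_rel n x y}"

definition HT :: "nat \<Rightarrow> gen ncpoly set ring"
  where "HT n = free_ring (ht_gens n) Quot ht_ideal n"

definition ht_class :: "nat \<Rightarrow> gen ncpoly \<Rightarrow> gen ncpoly set"
  where "ht_class n x = ht_ideal n +>\<^bsub>free_ring (ht_gens n)\<^esub> x"

lemma ht_gens_mem:
  "c \<in> coeff_gens n \<Longrightarrow> c \<in> ht_gens n"
  "GBeta \<in> ht_gens n" "GT \<in> ht_gens n"
  "2 \<le> i \<Longrightarrow> i \<le> n \<Longrightarrow> GH i \<in> ht_gens n"
  "1 \<le> i \<Longrightarrow> i < j \<Longrightarrow> j \<le> n \<Longrightarrow> GQ i j \<in> ht_gens n"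
  "1 \<le> i \<Longrightarrow> i < j \<Longrightarrow> j \<le> n \<Longrightarrow> GE i j \<in> ht_gens n"
  "1 \<le> i \<Longrightarrow> i < j \<Longrightarrow> j \<le> n \<Longrightarrow> GU i j \<in> ht_gens n"
  "1 \<le> i \<Longrightarrow> i \<le> n \<Longrightarrow> GZ i \<in> ht_gens n"
  by (auto simp: ht_gens_def coeff_gens_def)

lemma hpar_closed: "1 \<le> i \<Longrightarrow> i \<le> n \<Longrightarrow> hpar i \<in> carrier (free_ring (ht_gens n))"
  by (auto simp: hpar_def intro!: free_ring_closed intro: ht_gens_mem)

lemma ht_rel_closed:
  assumes "ht_rel n x y"
  shows "x \<in> carrier (free_ring (ht_gens n))" "y \<in> carrier (free_ring (ht_gens n))"
  using assms
  by (induction rule: ht_rel.induct)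
    (auto simp: power2_eq_square intro!: free_ring_closed hpar_closed intro: ht_gens_mem)

lemma ht_ideal_ideal: "ideal (ht_ideal n) (free_ring (ht_gens n))"
  unfolding ht_ideal_def
  by (rule ring.genideal_ideal[OF free_ring_ring])
    (auto intro: free_ring_closed ht_rel_closed)

lemma HT_ring: "ring (HT n)"
  unfolding HT_def by (rule ideal.quotient_is_ring[OF ht_ideal_ideal])

lemma ht_class_closed:
  "x \<in> carrier (free_ring (ht_gens n)) \<Longrightarrow> ht_class n x \<in> carrier (HT n)"
  by (auto simp: HT_def FactRing_def ht_class_def A_RCOSETS_def')

lemma ht_class_ring_hom: "ht_class n \<in> ring_hom (free_ring (ht_gens n)) (HT n)"
  unfolding HT_def ht_class_def by (rule ideal.rcos_ring_hom[OF ht_ideal_ideal])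

lemma ht_class_eq_if_rel:
  assumes "ht_rel n x y"
  shows "ht_class n x = ht_class n y"
proof -
  interpret ideal "ht_ideal n" "free_ring (ht_gens n)" by (rule ht_ideal_ideal)
  have minus: "a \<ominus>\<^bsub>free_ring (ht_gens n)\<^esub> b = a - b"
    if "b \<in> carrier (free_ring (ht_gens n))" for a b
  proof -
    have "\<ominus>\<^bsub>free_ring (ht_gens n)\<^esub> b = - b"
      using that by (intro minus_equality) (auto simp: free_ring_closed)
    then show ?thesis by (simp add: a_minus_def)
  qed
  have "x - y \<in> ht_ideal n"
    unfolding ht_ideal_def using assms
    by (intro subsetD[OF genideal_self]) (auto intro: free_ring_closed ht_rel_closed)
  then show ?thesis
    unfolding ht_class_def
    using quotient_eq_iff_same_a_r_cos[OF ht_ideal_ideal] ht_rel_closed[OF assms] minus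
    by metis
qed


section \<open>Shifted multiplicative Dunkl elements\<close>

definition ht_beta :: "nat \<Rightarrow> gen ncpoly set" where "ht_beta n = ht_class n (gvar GBeta)"
definition ht_t :: "nat \<Rightarrow> gen ncpoly set" where "ht_t n = ht_class n (gvar GT)"
definition ht_h :: "nat \<Rightarrow> nat \<Rightarrow> gen ncpoly set" where "ht_h n i = ht_class n (hpar i)"
definition ht_q :: "nat \<Rightarrow> nat \<Rightarrow> nat \<Rightarrow> gen ncpoly set" where "ht_q n i j = ht_class n (gvar (GQ i j))"
definition ht_u :: "nat \<Rightarrow> nat \<Rightarrow> nat \<Rightarrow> gen ncpoly set" where "ht_u n i j = ht_class n (gvar (GU i j))"
definition ht_z :: "nat \<Rightarrow> nat \<Rightarrow> gen ncpoly set" where "ht_z n i = ht_class n (gvar (GZ i))"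

definition oprod :: "('a, 'm) monoid_scheme \<Rightarrow> 'a list \<Rightarrow> 'a"
  where "oprod G xs = foldr (\<otimes>\<^bsub>G\<^esub>) xs \<one>\<^bsub>G\<^esub>"

definition h_elt :: "nat \<Rightarrow> nat \<Rightarrow> nat \<Rightarrow> gen ncpoly set"
  where "h_elt n i j = \<one>\<^bsub>HT n\<^esub> \<oplus>\<^bsub>HT n\<^esub> ht_t n \<otimes>\<^bsub>HT n\<^esub> ht_u n i j"

definition dunkl :: "nat \<Rightarrow> nat \<Rightarrow> gen ncpoly set"
  where "dunkl n i =
    oprod (HT n) (map (\<lambda>j. inv\<^bsub>HT n\<^esub> h_elt n j i) (rev [1..<i]))
    \<otimes>\<^bsub>HT n\<^esub> (\<one>\<^bsub>HT n\<^esub> \<oplus>\<^bsub>HT n\<^esub> ht_z n i)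
    \<otimes>\<^bsub>HT n\<^esub> oprod (HT n) (map (\<lambda>j. h_elt n i j) (rev [Suc i..<Suc n]))"

text \<open>The Dunkl elements commute, so the order of the factors (here increasing) is immaterial.\<close>

definition dunkl_prod :: "nat \<Rightarrow> nat set \<Rightarrow> gen ncpoly set"
  where "dunkl_prod n I = oprod (HT n) (map (dunkl n) (sorted_list_of_set I))"

text \<open>The polynomial \<open>((1 + t \<beta>)\<^sup>m - 1) / \<beta>\<close>.\<close>

definition shift_poly :: "nat \<Rightarrow> nat \<Rightarrow> gen ncpoly set"
  where "shift_poly n m = (\<Oplus>\<^bsub>HT n\<^esub>r\<in>{1..m}.
    add_pow (HT n) (m choose r) (ht_t n [^]\<^bsub>HT n\<^esub> r \<otimes>\<^bsub>HT n\<^esub> ht_beta n [^]\<^bsub>HT n\<^esub> (r - 1)))"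

end

theory Submission
  imports Defs "HOL-Library.Multiset"
begin

text \<open>
  Put \<open>s = 1 + t \<beta>\<close>, \<open>x\<^sub>i = 1 + z\<^sub>i\<close>, \<open>u\<^sub>j\<^sub>i = \<beta> - u\<^sub>i\<^sub>j\<close> for \<open>i < j\<close> and \<open>h\<^sub>i\<^sub>j = 1 + t u\<^sub>i\<^sub>j\<close> for all
  \<open>i \<noteq> j\<close>.  Then \<open>h\<^sub>i\<^sub>j + h\<^sub>j\<^sub>i = 1 + s\<close>, the product \<open>h\<^sub>i\<^sub>j h\<^sub>j\<^sub>i\<close> is the central element \<open>1 + t \<beta> - t\<^sup>2 q\<^sub>i\<^sub>j\<close>,
  and the \<open>h\<^sub>i\<^sub>j\<close> satisfy the Yang--Baxter equation.  Hence the summand of a set \<open>I\<close> becomes a product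
  of \<open>h\<^sub>j\<^sub>i\<close> with \<open>j \<in> I\<close>, \<open>i \<notin> I\<close>, those with \<open>i < j\<close> on the left of \<open>\<Prod>\<^sub>j\<^sub>\<in>\<^sub>I x\<^sub>j\<close> and those with \<open>i > j\<close> on
  its right; write \<open>E\<^sub>k(n)\<close> for the sum over all \<open>I\<close> with \<open>|I| = k\<close>.

  For \<open>k = 1\<close> and all \<open>x\<^sub>j = 1\<close> the sum over an index set \<open>S\<close> is the q-integer
  \<open>[|S|] = 1 + s + \<dots> + s\<^bsup>|S|-1\<^esup>\<close>, by the three-term relations.  This gives the step from \<open>n - 1\<close> to \<open>n\<close>
  for general \<open>k\<close>: applied to \<open>J \<union> {n}\<close>, it rewrites the product of the \<open>h\<^sub>j\<^sub>n\<close>, \<open>j \<in> J\<close>, as an expression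
  that is linear in the \<open>h\<^sub>j\<^sub>n\<close>; exchanging the distinguished \<open>j\<close> with the complement of \<open>J\<close>, applying
  the case \<open>k = 1\<close> to that complement, and exchanging back yields
  \<open>E\<^sub>k(n) = s\<^sup>k E\<^sub>k(n-1) + E\<^sub>k\<^sub>-\<^sub>1(n-1) (x\<^sub>n s\<^bsup>n-k\<^esup> + t (h\<^sub>n - \<beta>) [n-k])\<close>, the recursion of the right-hand side.
\<close>

section \<open>Sums of ordered products under the three-term relations\<close>

lemma commute_mult:
  fixes y :: "'a::semigroup_mult"
  shows "y * a = a * y \<Longrightarrow> y * b = b * y \<Longrightarrow> y * (a * b) = a * b * y"
  by (metis mult.assoc)

lemma commute_prod_list:
  fixes a :: "'a::monoid_mult"
  assumes "\<And>y. y \<in> set ys \<Longrightarrow> a * y = y * a"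
  shows "a * prod_list ys = prod_list ys * a"
  using assms
proof (induction ys)
  case (Cons b ys)
  have "a * (b * prod_list ys) = b * (a * prod_list ys)"
    using Cons.prems[of b] by (simp flip: mult.assoc)
  then show ?case using Cons by (simp add: mult.assoc)
qed simp

text \<open>The head of \<open>xs\<close> is located in \<open>ys\<close> and pulled to the front
  past factors with which it commutes. Products over sorted lists fix an order in the noncommutative
  ring; this frees them from it when the factors are the \<open>x i\<close> or the central
  \<open>c i j\<close>.\<close>

lemma prod_list_mset_eq:
  fixes xs ys :: "'a::monoid_mult list"
  assumes "mset xs = mset ys" "\<And>a b. a \<in> set xs \<Longrightarrow> b \<in> set xs \<Longrightarrow> a * b = b * a"
  shows "prod_list xs = prod_list ys"
  using assms
proof (induction xs arbitrary: ys)
  case (Cons a xs)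
  then have "a \<in> set ys" by (metis list.set_intros(1) mset_eq_setD)
  then obtain us vs where ys: "ys = us @ a # vs" by (meson split_list)
  have "mset xs = mset (us @ vs)" using Cons.prems(1) ys by simp
  then have eq: "prod_list xs = prod_list (us @ vs)"
    using Cons.prems(2) by (intro Cons.IH) auto
  have "set us \<subseteq> set (a # xs)" using Cons.prems(1) ys
    by (metis mset_eq_setD set_append le_supI1 order_refl)
  then have "a * prod_list us = prod_list us * a"
    using Cons.prems(2) by (intro commute_prod_list) auto
  then have "prod_list ys = a * (prod_list us * prod_list vs)"
    using ys by (simp flip: mult.assoc)
  then show ?case using eq by simp
qed simp

lemma sorted_list_of_set_union_less:
  fixes A B :: "'i::linorder set"
  assumes "finite A" "finite B" "\<And>a b. a \<in> A \<Longrightarrow> b \<in> B \<Longrightarrow> a < b"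
  shows "sorted_list_of_set (A \<union> B) = sorted_list_of_set A @ sorted_list_of_set B"
proof (rule sorted_distinct_set_unique)
  have "A \<inter> B = {}" using assms(3) by fastforce
  then show "distinct (sorted_list_of_set A @ sorted_list_of_set B)" using assms by simp
  show "sorted (sorted_list_of_set A @ sorted_list_of_set B)"
    using assms by (auto simp: sorted_append intro: less_imp_le)
qed (use assms in auto)

lemma sorted_list_of_set_insert_max:
  fixes e :: "'i::linorder"
  assumes "finite S" "\<And>i. i \<in> S \<Longrightarrow> i < e"
  shows "sorted_list_of_set (insert e S) = sorted_list_of_set S @ [e]"
  using sorted_list_of_set_union_less[of S "{e}"] assms by simp

section \<open>q-integers\<close>

text \<open>The q-integer at \<open>s\<close>, in the form free of division by
  \<open>s - 1\<close>.\<close>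

definition qint :: "'a::ring_1 \<Rightarrow> nat \<Rightarrow> 'a"
  where "qint s m = (\<Sum>i<m. s ^ i)"

lemma qint_simps [simp]: "qint s 0 = 0" "qint s (Suc m) = qint s m + s ^ m"
  by (simp_all add: qint_def)

lemma qint_Suc': "qint s (Suc m) = 1 + s * qint s m"
  by (simp add: qint_def sum.lessThan_Suc_shift sum_distrib_left del: sum.lessThan_Suc)

text \<open>The linear recurrence with characteristic polynomial \<open>X^2 - (1 + s) X + s\<close>.
  In this form the three-term relations determine the sums in \<open>dn_sum_one\<close> and
  \<open>up_sum_one\<close>.\<close>

lemma qint_Suc_Suc: "(1 + s) * qint s (Suc m) - s * qint s m = qint s (Suc (Suc m))"
proof -
  have "qint s (Suc (Suc m)) = 1 + s * qint s (Suc m)" by (rule qint_Suc')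
  then show ?thesis using qint_Suc'[of s m] by (simp add: algebra_simps del: qint_simps)
qed

text \<open>Prepares the inductions of \<open>dn_sum_one\<close> and \<open>up_sum_one\<close>,
  which split off two indices at once because a three-term relation involves two indices besides the
  summation index.\<close>

lemma two_maxima:
  assumes "finite (S :: nat set)" "2 \<le> card S"
  obtains S' a b where "S = insert b (insert a S')" "finite S'" "\<And>i. i \<in> S' \<Longrightarrow> i < a" "a < b"
    "card S = Suc (Suc (card S'))"
proof -
  define b where "b = Max S"
  define a where "a = Max (S - {b})"
  have ne: "S \<noteq> {}" using assms by auto
  then have b: "b \<in> S" "\<And>i. i \<in> S \<Longrightarrow> i \<le> b" using assms unfolding b_def by auto
  have "card (S - {b}) = card S - 1" using b assms by simp
  then have "S - {b} \<noteq> {}" using assms(2) by (metis card.empty diff_is_0_eq not_less_eq_eq numeral_2_eq_2 One_nat_def)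
  then have a: "a \<in> S - {b}" "\<And>i. i \<in> S - {b} \<Longrightarrow> i \<le> a" using assms unfolding a_def
    by (auto intro!: Max_in Max_ge simp del: Diff_iff)
  show thesis
  proof (rule that[of b a "S - {b} - {a}"])
    show "S = insert b (insert a (S - {b} - {a}))" using a b by auto
    show "card S = Suc (Suc (card (S - {b} - {a})))"
      using a b assms by (simp add: card_Diff_singleton)
    show "i < a" if "i \<in> S - {b} - {a}" for i using that a(2)[of i] by auto
    show "a < b" using a(1) b(2)[of a] by auto
  qed (use assms in auto)
qed

section \<open>Axioms for the factors \<open>h i j\<close>, and ordered products of them\<close>

text \<open>The consequences of the presentation on which the combinatorics rests. For
  \<open>i < j\<close> the element \<open>h j i\<close> stands for
  \<open>1 + t * (b - u i j)\<close>. On the left of \<open>h_out\<close> the two factors share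
  their first index, in \<open>h_in\<close> their second. The quadratic relations act through
  \<open>yb_up\<close> and \<open>yb_dn\<close>.\<close>

locale three_term =
  fixes N :: nat and s :: "'a::ring_1" and h :: "nat \<Rightarrow> nat \<Rightarrow> 'a"
  assumes s_central: "s * y = y * s"
    and h_sum: "1 \<le> i \<Longrightarrow> i < j \<Longrightarrow> j \<le> N \<Longrightarrow> h i j + h j i = 1 + s"
    and h_comm: "{i, j, k, l} \<subseteq> {1..N} \<Longrightarrow> i \<noteq> j \<Longrightarrow> k \<noteq> l \<Longrightarrow> {i, j} \<inter> {k, l} = {} \<Longrightarrow>
      h i j * h k l = h k l * h i j"
    and h_out: "1 \<le> i \<Longrightarrow> i < j \<Longrightarrow> j < k \<Longrightarrow> k \<le> N \<Longrightarrow>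
      h i k * h i j = h k j * h i k + h i j * h j k - s"
    and h_in: "1 \<le> i \<Longrightarrow> i < j \<Longrightarrow> j < k \<Longrightarrow> k \<le> N \<Longrightarrow>
      h j i * h k i = h k j * h j i + h k i * h j k - s"
    and yb_up: "1 \<le> i \<Longrightarrow> i < j \<Longrightarrow> j < k \<Longrightarrow> k \<le> N \<Longrightarrow>
      h i j * h i k * h j k = h j k * h i k * h i j"
    and yb_dn: "1 \<le> i \<Longrightarrow> i < j \<Longrightarrow> j < k \<Longrightarrow> k \<le> N \<Longrightarrow>
      h k j * h k i * h j i = h j i * h k i * h k j"
begin

text \<open>The decreasing order is that of both halves of a Dunkl element. \<open>up\<close>, where
  the fixed index comes second, needs the opposite order for \<open>yb_up_set\<close> to
  hold.\<close>

definition dn :: "nat \<Rightarrow> nat set \<Rightarrow> 'a"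
  where "dn j S = prod_list (map (h j) (rev (sorted_list_of_set S)))"

definition up :: "nat set \<Rightarrow> nat \<Rightarrow> 'a"
  where "up S j = prod_list (map (\<lambda>i. h i j) (sorted_list_of_set S))"

lemma dn_empty [simp]: "dn j {} = 1" and up_empty [simp]: "up {} j = 1"
  by (simp_all add: dn_def up_def)

lemma dn_insert: "finite S \<Longrightarrow> \<forall>i\<in>S. i < e \<Longrightarrow> dn j (insert e S) = h j e * dn j S"
  and up_insert: "finite S \<Longrightarrow> \<forall>i\<in>S. i < e \<Longrightarrow> up (insert e S) j = up S j * h e j"
  by (simp_all add: dn_def up_def sorted_list_of_set_insert_max del: sorted_list_of_set_insert_remove)

lemma dn_union: "finite A \<Longrightarrow> finite B \<Longrightarrow> (\<And>a b. a \<in> A \<Longrightarrow> b \<in> B \<Longrightarrow> a < b) \<Longrightarrow>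
    dn j (A \<union> B) = dn j B * dn j A"
  and up_union: "finite A \<Longrightarrow> finite B \<Longrightarrow> (\<And>a b. a \<in> A \<Longrightarrow> b \<in> B \<Longrightarrow> a < b) \<Longrightarrow>
    up (A \<union> B) j = up A j * up B j"
  by (simp_all add: dn_def up_def sorted_list_of_set_union_less)

lemma commute_dn: "finite S \<Longrightarrow> (\<And>i. i \<in> S \<Longrightarrow> y * h j i = h j i * y) \<Longrightarrow> y * dn j S = dn j S * y"
  and commute_up: "finite S \<Longrightarrow> (\<And>i. i \<in> S \<Longrightarrow> y * h i j = h i j * y) \<Longrightarrow> y * up S j = up S j * y"
  unfolding dn_def up_def by (auto intro!: commute_prod_list)

lemma qint_central: "qint s m * y = y * qint s m"
proof (induction m)
  case (Suc m)
  have "s ^ m * y = y * s ^ m"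
    by (induction m) (simp_all add: mult.assoc s_central, simp flip: mult.assoc add: s_central)
  with Suc show ?case by (simp add: algebra_simps)
qed simp

section \<open>The sum for one-element sets and its mirror image\<close>

text \<open>For \<open>f = x\<close> this is the sum of the overview with \<open>k = 1\<close> and
  index set \<open>S\<close>. A general \<open>f\<close> is allowed because \<open>f j\<close>
  absorbs factors when indices are split off.\<close>

definition dn_sum :: "(nat \<Rightarrow> 'a) \<Rightarrow> nat set \<Rightarrow> 'a"
  where "dn_sum f S = (\<Sum>j\<in>S. dn j {i \<in> S. i < j} * f j * dn j {i \<in> S. j < i})"

text \<open>The form that a \<open>dn_sum\<close> over the complement of a set takes under
  \<open>exchange_sum\<close>.\<close>

definition up_sum :: "(nat \<Rightarrow> 'a) \<Rightarrow> nat set \<Rightarrow> 'a"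
  where "up_sum f S = (\<Sum>j\<in>S. up {i \<in> S. j < i} j * f j * up {i \<in> S. i < j} j)"

text \<open>The decreasing order puts the factor \<open>h j e\<close> of the largest index directly
  behind \<open>f j\<close>, where it becomes part of the function. The index \<open>e\<close>
  itself contributes the boundary term.\<close>

lemma dn_sum_insert:
  assumes "finite S" "\<And>i. i \<in> S \<Longrightarrow> i < e"
  shows "dn_sum f (insert e S) = dn_sum (\<lambda>j. f j * h j e) S + dn e S * f e"
proof -
  have e: "e \<notin> S" using assms(2) by blast
  have last: "{i \<in> insert e S. i < e} = S" "{i \<in> insert e S. e < i} = {}"
    using assms(2) by (auto dest: order.asym)
  have "(\<Sum>j\<in>S. dn j {i \<in> insert e S. i < j} * f j * dn j {i \<in> insert e S. j < i})
      = (\<Sum>j\<in>S. dn j {i \<in> S. i < j} * (f j * h j e) * dn j {i \<in> S. j < i})"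
  proof (rule sum.cong)
    fix j assume j: "j \<in> S"
    then have "{i \<in> insert e S. i < j} = {i \<in> S. i < j}"
      "{i \<in> insert e S. j < i} = insert e {i \<in> S. j < i}"
      using assms(2)[OF j] by (auto dest: order.asym)
    then show "dn j {i \<in> insert e S. i < j} * f j * dn j {i \<in> insert e S. j < i}
      = dn j {i \<in> S. i < j} * (f j * h j e) * dn j {i \<in> S. j < i}"
      using assms dn_insert[of "{i \<in> S. j < i}" e j] by (simp add: mult.assoc)
  qed simp
  then show ?thesis
    unfolding dn_sum_def sum.insert[OF assms(1) e] last by (simp add: add.commute)
qed

lemma up_sum_insert:
  assumes "finite S" "\<And>i. i \<in> S \<Longrightarrow> i < e"
  shows "up_sum f (insert e S) = up_sum (\<lambda>j. h e j * f j) S + f e * up S e"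
proof -
  have e: "e \<notin> S" using assms(2) by blast
  have last: "{i \<in> insert e S. i < e} = S" "{i \<in> insert e S. e < i} = {}"
    using assms(2) by (auto dest: order.asym)
  have "(\<Sum>j\<in>S. up {i \<in> insert e S. j < i} j * f j * up {i \<in> insert e S. i < j} j)
      = (\<Sum>j\<in>S. up {i \<in> S. j < i} j * (h e j * f j) * up {i \<in> S. i < j} j)"
  proof (rule sum.cong)
    fix j assume j: "j \<in> S"
    then have "{i \<in> insert e S. i < j} = {i \<in> S. i < j}"
      "{i \<in> insert e S. j < i} = insert e {i \<in> S. j < i}"
      using assms(2)[OF j] by (auto dest: order.asym)
    then show "up {i \<in> insert e S. j < i} j * f j * up {i \<in> insert e S. i < j} j
      = up {i \<in> S. j < i} j * (h e j * f j) * up {i \<in> S. i < j} j"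
      using assms up_insert[of "{i \<in> S. j < i}" e j] by (simp add: mult.assoc)
  qed simp
  then show ?thesis
    unfolding up_sum_def sum.insert[OF assms(1) e] last by (simp add: add.commute)
qed

lemma dn_sum_cong: "(\<And>j. j \<in> S \<Longrightarrow> f j = f' j) \<Longrightarrow> dn_sum f S = dn_sum f' S"
  and up_sum_cong: "(\<And>j. j \<in> S \<Longrightarrow> f j = f' j) \<Longrightarrow> up_sum f S = up_sum f' S"
  by (simp_all add: dn_sum_def up_sum_def)

lemma dn_sum_add: "dn_sum (\<lambda>j. f j + f' j) S = dn_sum f S + dn_sum f' S"
  and dn_sum_diff: "dn_sum (\<lambda>j. f j - f' j) S = dn_sum f S - dn_sum f' S"
  and up_sum_add: "up_sum (\<lambda>j. f j + f' j) S = up_sum f S + up_sum f' S"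
  and up_sum_diff: "up_sum (\<lambda>j. f j - f' j) S = up_sum f S - up_sum f' S"
  by (simp_all add: dn_sum_def up_sum_def algebra_simps sum.distrib sum_subtractf)

text \<open>At the edge of the middle factor, \<open>y\<close> has to pass only an ordered product
  of \<open>h\<close>, never an \<open>f j\<close>; hence the separate versions for the two
  sides.\<close>

lemma dn_sum_right: "(\<And>i. i \<in> S \<Longrightarrow> \<forall>j\<in>S. i \<noteq> j \<longrightarrow> y * h i j = h i j * y) \<Longrightarrow> finite S \<Longrightarrow>
    dn_sum (\<lambda>j. f j * y) S = dn_sum f S * y"
  unfolding dn_sum_def sum_distrib_right
  by (intro sum.cong) (auto simp: mult.assoc intro!: commute_dn arg_cong[of _ _ "(*) _"])

lemma dn_sum_left: "(\<And>i. i \<in> S \<Longrightarrow> \<forall>j\<in>S. i \<noteq> j \<longrightarrow> y * h i j = h i j * y) \<Longrightarrow> finite S \<Longrightarrow>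
    dn_sum (\<lambda>j. y * f j) S = y * dn_sum f S"
  unfolding dn_sum_def sum_distrib_left
  by (intro sum.cong)
    (auto simp flip: mult.assoc intro!: commute_dn[symmetric] arg_cong[of _ _ "\<lambda>z. z * _ * _"])

lemma up_sum_right: "(\<And>i. i \<in> S \<Longrightarrow> \<forall>j\<in>S. i \<noteq> j \<longrightarrow> y * h i j = h i j * y) \<Longrightarrow> finite S \<Longrightarrow>
    up_sum (\<lambda>j. f j * y) S = up_sum f S * y"
  unfolding up_sum_def sum_distrib_right
  by (intro sum.cong) (auto simp: mult.assoc intro!: commute_up arg_cong[of _ _ "(*) _"])

lemma up_sum_left: "(\<And>i. i \<in> S \<Longrightarrow> \<forall>j\<in>S. i \<noteq> j \<longrightarrow> y * h i j = h i j * y) \<Longrightarrow> finite S \<Longrightarrow>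
    up_sum (\<lambda>j. y * f j) S = y * up_sum f S"
  unfolding up_sum_def sum_distrib_left
  by (intro sum.cong)
    (auto simp flip: mult.assoc intro!: commute_up[symmetric] arg_cong[of _ _ "\<lambda>z. z * _ * _"])

text \<open>Strong induction on the cardinality. With \<open>a < b\<close> the two largest indices,
  \<open>h_out\<close> rewrites \<open>h j b * h j a\<close>; the resulting sums belong to smaller
  sets, the boundary terms cancel, and \<open>qint_Suc_Suc\<close> remains.\<close>

lemma dn_sum_one: "finite S \<Longrightarrow> S \<subseteq> {1..N} \<Longrightarrow> dn_sum (\<lambda>j. 1) S = qint s (card S)"
proof (induction "card S" arbitrary: S rule: less_induct)
  case less
  consider "card S = 0" | "card S = 1" | "2 \<le> card S" by linarith
  then show ?case
  proof cases
    case 1 then show ?thesis using less.prems by (simp add: dn_sum_def)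
  next
    case 2
    then obtain e where "S = {e}" by (auto simp: card_1_singleton_iff)
    then show ?thesis using dn_sum_insert[of "{}" e "\<lambda>_. 1"] by (simp add: dn_sum_def)
  next
    case 3
    obtain S' a b where S: "S = insert b (insert a S')" "finite S'" "\<And>i. i \<in> S' \<Longrightarrow> i < a" "a < b"
      "card S = Suc (Suc (card S'))" by (rule two_maxima[OF less.prems(1) 3]) blast
    have lt: "i < b" "i < a" "i \<noteq> a" "i \<noteq> b" if "i \<in> S'" for i
      using S(3)[OF that] S(4) by auto
    have not_in: "a \<notin> S'" "b \<notin> S'" "b \<notin> insert a S'" using lt S(4) by auto
    have bnd: "a \<in> {1..N}" "b \<in> {1..N}" "\<And>i. i \<in> S' \<Longrightarrow> i \<in> {1..N}" using less.prems(2) S(1) by auto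
    then have sub: "insert a S' \<subseteq> {1..N}" "insert b S' \<subseteq> {1..N}" "S' \<subseteq> {1..N}" by blast+
    have comm: "h c d * h i j = h i j * h c d"
      if "c \<in> {a,b}" "d \<in> {a,b}" "c \<noteq> d" "i \<in> S'" "j \<in> S'" "i \<noteq> j" for c d i j
      using that bnd lt[of i] lt[of j] by (intro h_comm) auto
    have "dn_sum (\<lambda>j. 1) S = dn_sum (\<lambda>j. h j b * h j a) S' + dn a S' * h a b + h b a * dn b S'"
      unfolding S(1) using S lt
      by (subst dn_sum_insert, force, force, subst dn_sum_insert) (auto simp: dn_insert)
    also have "dn_sum (\<lambda>j. h j b * h j a) S' = dn_sum (\<lambda>j. h b a * h j b + h j a * h a b - s * 1) S'"
      by (rule dn_sum_cong) (use bnd lt S(4) in \<open>auto intro!: h_out\<close>)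
    \<comment> \<open>\<open>h a b\<close> and \<open>h b a\<close> share no index with the factors
      over \<open>S'\<close>, so each leaves the sum on the side where it stands.\<close>
    also have "\<dots> = h b a * dn_sum (\<lambda>j. h j b) S' + dn_sum (\<lambda>j. h j a) S' * h a b - s * dn_sum (\<lambda>j. 1) S'"
    proof -
      have "dn_sum (\<lambda>j. h b a * h j b) S' = h b a * dn_sum (\<lambda>j. h j b) S'"
        by (rule dn_sum_left) (use S(2,4) comm in auto)
      moreover have "dn_sum (\<lambda>j. h j a * h a b) S' = dn_sum (\<lambda>j. h j a) S' * h a b"
        by (rule dn_sum_right) (use S(2,4) comm in auto)
      moreover have "dn_sum (\<lambda>j. s * 1) S' = s * dn_sum (\<lambda>j. 1) S'"
        by (rule dn_sum_left) (use S(2,4) s_central in auto)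
      ultimately show ?thesis by (simp only: dn_sum_add dn_sum_diff)
    qed
    \<comment> \<open>\<open>dn_sum_insert\<close> read backwards; the subtracted term cancels a
      boundary term of \<open>S\<close>.\<close>
    also have "dn_sum (\<lambda>j. h j b) S' = dn_sum (\<lambda>j. 1) (insert b S') - dn b S'"
      using S lt by (simp add: dn_sum_insert)
    also have "dn_sum (\<lambda>j. h j a) S' = dn_sum (\<lambda>j. 1) (insert a S') - dn a S'"
      using S lt by (simp add: dn_sum_insert)
    also have "dn_sum (\<lambda>j. 1) (insert a S') = qint s (Suc (card S'))"
      using less.hyps[OF _ _ sub(1)] S not_in by (auto simp del: qint_simps)
    also have "dn_sum (\<lambda>j. 1) (insert b S') = qint s (Suc (card S'))"
      using less.hyps[OF _ _ sub(2)] S not_in by (auto simp del: qint_simps)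
    also have "dn_sum (\<lambda>j. 1) S' = qint s (card S')"
      using less.hyps[OF _ _ sub(3)] S not_in by (auto simp del: qint_simps)
    \<comment> \<open>\<open>h b a\<close> and \<open>h a b\<close> stand on opposite sides; they
      combine because q-integers are central.\<close>
    finally have "dn_sum (\<lambda>j. 1) S = (h a b + h b a) * qint s (Suc (card S')) - s * qint s (card S')"
      by (simp add: algebra_simps qint_central del: qint_simps)
    also have "\<dots> = qint s (card S)"
      using h_sum[of a b] bnd S(4) S(5) qint_Suc_Suc by (simp del: qint_simps)
    finally show ?thesis .
  qed
qed

text \<open>The mirror image of \<open>dn_sum_one\<close>, with \<open>h_in\<close> in place of
  \<open>h_out\<close>.\<close>

lemma up_sum_one: "finite S \<Longrightarrow> S \<subseteq> {1..N} \<Longrightarrow> up_sum (\<lambda>j. 1) S = qint s (card S)"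
proof (induction "card S" arbitrary: S rule: less_induct)
  case less
  consider "card S = 0" | "card S = 1" | "2 \<le> card S" by linarith
  then show ?case
  proof cases
    case 1 then show ?thesis using less.prems by (simp add: up_sum_def)
  next
    case 2
    then obtain e where "S = {e}" by (auto simp: card_1_singleton_iff)
    then show ?thesis using up_sum_insert[of "{}" e "\<lambda>_. 1"] by (simp add: up_sum_def)
  next
    case 3
    obtain S' a b where S: "S = insert b (insert a S')" "finite S'" "\<And>i. i \<in> S' \<Longrightarrow> i < a" "a < b"
      "card S = Suc (Suc (card S'))" by (rule two_maxima[OF less.prems(1) 3]) blast
    have lt: "i < b" "i < a" "i \<noteq> a" "i \<noteq> b" if "i \<in> S'" for i
      using S(3)[OF that] S(4) by auto
    have not_in: "a \<notin> S'" "b \<notin> S'" "b \<notin> insert a S'" using lt S(4) by auto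
    have bnd: "a \<in> {1..N}" "b \<in> {1..N}" "\<And>i. i \<in> S' \<Longrightarrow> i \<in> {1..N}" using less.prems(2) S(1) by auto
    then have sub: "insert a S' \<subseteq> {1..N}" "insert b S' \<subseteq> {1..N}" "S' \<subseteq> {1..N}" by blast+
    have comm: "h c d * h i j = h i j * h c d"
      if "c \<in> {a,b}" "d \<in> {a,b}" "c \<noteq> d" "i \<in> S'" "j \<in> S'" "i \<noteq> j" for c d i j
      using that bnd lt[of i] lt[of j] by (intro h_comm) auto
    have "up_sum (\<lambda>j. 1) S = up_sum (\<lambda>j. h a j * h b j) S' + h b a * up S' a + up S' b * h a b"
      unfolding S(1) using S lt
      by (subst up_sum_insert, force, force, subst up_sum_insert) (auto simp: up_insert)
    also have "up_sum (\<lambda>j. h a j * h b j) S' = up_sum (\<lambda>j. h b a * h a j + h b j * h a b - s * 1) S'"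
      by (rule up_sum_cong) (use bnd lt S(4) in \<open>auto intro!: h_in\<close>)
    also have "\<dots> = h b a * up_sum (\<lambda>j. h a j) S' + up_sum (\<lambda>j. h b j) S' * h a b - s * up_sum (\<lambda>j. 1) S'"
    proof -
      have "up_sum (\<lambda>j. h b a * h a j) S' = h b a * up_sum (\<lambda>j. h a j) S'"
        by (rule up_sum_left) (use S(2,4) comm in auto)
      moreover have "up_sum (\<lambda>j. h b j * h a b) S' = up_sum (\<lambda>j. h b j) S' * h a b"
        by (rule up_sum_right) (use S(2,4) comm in auto)
      moreover have "up_sum (\<lambda>j. s * 1) S' = s * up_sum (\<lambda>j. 1) S'"
        by (rule up_sum_left) (use S(2,4) s_central in auto)
      ultimately show ?thesis by (simp only: up_sum_add up_sum_diff)
    qed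
    also have "up_sum (\<lambda>j. h b j) S' = up_sum (\<lambda>j. 1) (insert b S') - up S' b"
      using S lt by (simp add: up_sum_insert)
    also have "up_sum (\<lambda>j. h a j) S' = up_sum (\<lambda>j. 1) (insert a S') - up S' a"
      using S lt by (simp add: up_sum_insert)
    also have "up_sum (\<lambda>j. 1) (insert a S') = qint s (Suc (card S'))"
      using less.hyps[OF _ _ sub(1)] S not_in by (auto simp del: qint_simps)
    also have "up_sum (\<lambda>j. 1) (insert b S') = qint s (Suc (card S'))"
      using less.hyps[OF _ _ sub(2)] S not_in by (auto simp del: qint_simps)
    also have "up_sum (\<lambda>j. 1) S' = qint s (card S')"
      using less.hyps[OF _ _ sub(3)] S not_in by (auto simp del: qint_simps)
    finally have "up_sum (\<lambda>j. 1) S = (h a b + h b a) * qint s (Suc (card S')) - s * qint s (card S')"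
      by (simp add: algebra_simps qint_central del: qint_simps)
    also have "\<dots> = qint s (card S)"
      using h_sum[of a b] bnd S(4) S(5) qint_Suc_Suc by (simp del: qint_simps)
    finally show ?thesis .
  qed
qed

end

section \<open>Exchanging an index with its complement\<close>

context three_term begin

section \<open>Commutation for disjoint indices and Yang--Baxter for whole rows\<close>

lemma h_commute_up:
  assumes "A \<subseteq> {1..N}" "{a, i, j} \<subseteq> {1..N}" "i \<noteq> j" "a \<notin> A" "{i, j} \<inter> insert a A = {}"
  shows "h i j * up A a = up A a * h i j"
  using assms finite_subset[OF assms(1)] by (intro commute_up h_comm) auto

lemma h_commute_dn:
  assumes "A \<subseteq> {1..N}" "{a, i, j} \<subseteq> {1..N}" "i \<noteq> j" "a \<notin> A" "{i, j} \<inter> insert a A = {}"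
  shows "h i j * dn a A = dn a A * h i j"
  using assms finite_subset[OF assms(1)] by (intro commute_dn h_comm) auto

lemma up_commute_up:
  assumes "A \<subseteq> {1..N}" "B \<subseteq> {1..N}" "{a, b} \<subseteq> {1..N}" "a \<notin> A" "b \<notin> B" "insert a A \<inter> insert b B = {}"
  shows "up A a * up B b = up B b * up A a"
  using assms finite_subset[OF assms(2)]
  by (intro commute_up h_commute_up[symmetric]) auto

lemma up_commute_dn:
  assumes "A \<subseteq> {1..N}" "B \<subseteq> {1..N}" "{a, b} \<subseteq> {1..N}" "a \<notin> A" "b \<notin> B" "insert a A \<inter> insert b B = {}"
  shows "up A a * dn b B = dn b B * up A a"
  using assms finite_subset[OF assms(2)]
  by (intro commute_dn h_commute_up[symmetric]) auto

lemma dn_commute_dn: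
  assumes "A \<subseteq> {1..N}" "B \<subseteq> {1..N}" "{a, b} \<subseteq> {1..N}" "a \<notin> A" "b \<notin> B" "insert a A \<inter> insert b B = {}"
  shows "dn a A * dn b B = dn b B * dn a A"
  using assms finite_subset[OF assms(2)]
  by (intro commute_dn h_commute_dn[symmetric]) auto

text \<open>Induction on the largest element \<open>p\<close> of \<open>P\<close>:
  \<open>yb_up\<close> moves \<open>h j e\<close> past one pair \<open>h p e\<close>,
  \<open>h p j\<close>, and the factors in between commute because their indices are
  disjoint.\<close>

lemma yb_up_set:
  assumes "finite P" "P \<subseteq> {1..<j}" "j < e" "e \<le> N"
  shows "h j e * up P e * up P j = up P j * up P e * h j e"
  using assms
proof (induction P rule: finite_linorder_max_induct)
  case (insert p P)
  have ub: "\<forall>i\<in>P. i < p" using insert.hyps by auto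
  have 1: "h p e * up P j = up P j * h p e" "h p j * up P e = up P e * h p j"
    by (rule h_commute_up; use insert.prems insert.hyps in fastforce)+
  have "h j e * up (insert p P) e * up (insert p P) j = h j e * up P e * (h p e * up P j) * h p j"
    using up_insert[OF insert.hyps(1) ub] by (simp add: mult.assoc)
  also have "\<dots> = (h j e * up P e * up P j) * (h p e * h p j)"
    by (simp add: mult.assoc 1)
  also have "\<dots> = up P j * up P e * (h j e * h p e * h p j)"
    using insert by (simp add: mult.assoc)
  also have "h j e * h p e * h p j = h p j * h p e * h j e"
    using insert.prems by (intro yb_up[symmetric]) auto
  also have "up P j * up P e * (h p j * h p e * h j e) = up P j * (h p j * up P e) * h p e * h j e"
    by (simp add: mult.assoc 1)
  also have "\<dots> = up (insert p P) j * up (insert p P) e * h j e"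
    using up_insert[OF insert.hyps(1) ub] by (simp add: mult.assoc)
  finally show ?case .
qed simp

lemma yb_dn_set:
  assumes "finite P" "P \<subseteq> {1..<j}" "j < e" "e \<le> N"
  shows "h e j * dn e P * dn j P = dn j P * dn e P * h e j"
  using assms
proof (induction P rule: finite_linorder_max_induct)
  case (insert p P)
  have ub: "\<forall>i\<in>P. i < p" using insert.hyps by auto
  have 1: "h j p * dn e P = dn e P * h j p" "h e p * dn j P = dn j P * h e p"
    by (rule h_commute_dn; use insert.prems insert.hyps in fastforce)+
  have "h e j * dn e (insert p P) * dn j (insert p P) = h e j * h e p * (dn e P * h j p) * dn j P"
    using dn_insert[OF insert.hyps(1) ub] by (simp add: mult.assoc)
  also have "\<dots> = (h e j * h e p * h j p) * (dn e P * dn j P)"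
    by (simp add: mult.assoc flip: 1)
  also have "h e j * h e p * h j p = h j p * h e p * h e j"
    using insert.prems by (intro yb_dn) auto
  also have "h j p * h e p * h e j * (dn e P * dn j P) = h j p * h e p * (h e j * dn e P * dn j P)"
    by (simp add: mult.assoc)
  also have "\<dots> = h j p * (h e p * dn j P) * dn e P * h e j"
    using insert by (simp add: mult.assoc)
  also have "\<dots> = dn j (insert p P) * dn e (insert p P) * h e j"
    using dn_insert[OF insert.hyps(1) ub] by (simp add: mult.assoc 1)
  finally show ?case .
qed simp

section \<open>The two halves of a summand\<close>

text \<open>The summand of \<open>I\<close> in the overview is
  \<open>left n I * x_prod I * right n I\<close>. Factors are grouped by the element of
  \<open>I\<close> here and by the index outside \<open>I\<close> in \<open>right\<close>, so that a
  new largest index adds a row to exactly one half.\<close>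

primrec left :: "nat \<Rightarrow> nat set \<Rightarrow> 'a" where
  "left 0 I = 1"
| "left (Suc m) I = left m I * (if Suc m \<in> I then dn (Suc m) ({1..m} - I) else 1)"

primrec right :: "nat \<Rightarrow> nat set \<Rightarrow> 'a" where
  "right 0 I = 1"
| "right (Suc m) I = (if Suc m \<in> I then 1 else up ({1..m} \<inter> I) (Suc m)) * right m I"

lemma left_cong: "{1..m} \<inter> I = {1..m} \<inter> I' \<Longrightarrow> left m I = left m I'"
  and right_cong: "{1..m} \<inter> I = {1..m} \<inter> I' \<Longrightarrow> right m I = right m I'"
proof (induction m)
  case (Suc m)
  have *: "{1..Suc m} = insert (Suc m) {1..m}" by auto
  { case 1
    then have "{1..m} \<inter> I = {1..m} \<inter> I'" "Suc m \<in> I \<longleftrightarrow> Suc m \<in> I'" unfolding * by auto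
    moreover from this have "{1..m} - I = {1..m} - I'" by auto
    ultimately show ?case using Suc(1) by simp }
  { case 2
    then have "{1..m} \<inter> I = {1..m} \<inter> I'" "Suc m \<in> I \<longleftrightarrow> Suc m \<in> I'" unfolding * by auto
    then show ?case using Suc(2) by simp }
qed simp_all

lemma commute_right:
  "(\<And>i j. i \<in> {1..m} \<Longrightarrow> j \<in> {1..m} \<Longrightarrow> i \<in> I \<Longrightarrow> j \<notin> I \<Longrightarrow> y * h i j = h i j * y) \<Longrightarrow>
    y * right m I = right m I * y"
proof (induction m)
  case (Suc m)
  have "y * right m I = right m I * y" using Suc by simp
  moreover have "y * up ({1..m} \<inter> I) (Suc m) = up ({1..m} \<inter> I) (Suc m) * y" if "Suc m \<notin> I"
    using Suc.prems that by (intro commute_up) auto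
  ultimately show ?case by (auto intro!: commute_mult)
qed simp

text \<open>
  Both sides of each equation are products of the same \<open>h\<close>; moving \<open>j\<close> from the complement of \<open>J\<close> into
  the set only reorders them by the Yang--Baxter equation.
\<close>

lemma exchange:
  assumes "1 \<le> j" "j \<notin> J" "j \<le> n" "n \<le> N"
  shows left_exchange: "left n J * dn j ({1..<j} - J) = left n (insert j J) * up ({j<..n} \<inter> J) j"
    and right_exchange: "dn j ({j<..n} - J) * right n J = up ({1..<j} \<inter> J) j * right n (insert j J)"
proof -
  have "left n J * dn j ({1..<j} - J) = left n (insert j J) * up ({j<..n} \<inter> J) j \<and>
    dn j ({j<..n} - J) * right n J = up ({1..<j} \<inter> J) j * right n (insert j J)"
    using assms(3,4)
  proof (induction n rule: dec_induct)
    \<comment> \<open>For \<open>n = j\<close> no index exceeds \<open>j\<close>, and inserting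
      \<open>j\<close> into \<open>J\<close> moves its row from the right half to the left
      half.\<close>
    case base
    obtain m where m: "j = Suc m" using assms(1) by (cases j) auto
    have "left m (insert j J) = left m J" "right m (insert j J) = right m J"
      by (rule left_cong right_cong; use m in auto)+
    moreover have "{1..m} - insert j J = {1..<j} - J" "{1..m} \<inter> J = {1..<j} \<inter> J" using m by auto
    ultimately show ?case using m assms(2) by simp
  next
    case (step n)
    define e where "e = Suc n"
    have e: "j < e" "e \<le> N" "n < e" using step e_def by auto
    let ?J = "insert j J" and ?Cl = "{1..<j} - J" and ?Cg = "{j<..n} - J"
      and ?Jl = "{1..<j} \<inter> J" and ?Jg = "{j<..n} \<inter> J"
    have IH: "left n J * dn j ?Cl = left n ?J * up ?Jg j"
      "dn j ?Cg * right n J = up ?Jl j * right n ?J" using step by auto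
    show ?case
    \<comment> \<open>If \<open>e\<close> lies in \<open>J\<close>, only the left equation gains
      factors, otherwise only the right one; the other equation is the induction hypothesis.\<close>
    proof (cases "e \<in> J")
      case True
      have sets: "{j<..e} - J = ?Cg" "{j<..e} \<inter> J = insert e ?Jg" "{1..n} - ?J = ?Cl \<union> ?Cg"
        "{1..n} - J = insert j ?Cl \<union> ?Cg"
        using True assms(1,2) step.hyps unfolding e_def by (auto simp: le_Suc_eq)
      have c1: "dn e ?Cg * dn j ?Cl = dn j ?Cl * dn e ?Cg"
        by (rule dn_commute_dn) (use e assms step in auto)
      have c2: "up ?Jg j * dn e (?Cl \<union> ?Cg) = dn e (?Cl \<union> ?Cg) * up ?Jg j"
        by (rule up_commute_dn) (use e assms step True in auto)
      have "left e J * dn j ?Cl = left n J * (dn e ({1..n} - J) * dn j ?Cl)"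
        using True by (simp add: e_def mult.assoc)
      also have "dn e ({1..n} - J) = dn e ?Cg * (h e j * dn e ?Cl)"
        unfolding sets by (subst dn_union) (auto simp: dn_insert)
      also have "left n J * (dn e ?Cg * (h e j * dn e ?Cl) * dn j ?Cl)
          = left n J * dn e ?Cg * (h e j * dn e ?Cl * dn j ?Cl)"
        by (simp add: mult.assoc)
      \<comment> \<open>\<open>h e j\<close> is moved behind both rows, where it becomes the new
        factor of \<open>up\<close>.\<close>
      also have "h e j * dn e ?Cl * dn j ?Cl = dn j ?Cl * dn e ?Cl * h e j"
        by (rule yb_dn_set) (use e in auto)
      also have "left n J * dn e ?Cg * (dn j ?Cl * dn e ?Cl * h e j)
          = left n J * (dn e ?Cg * dn j ?Cl) * dn e ?Cl * h e j"
        by (simp add: mult.assoc)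
      also have "\<dots> = (left n J * dn j ?Cl) * (dn e ?Cg * dn e ?Cl) * h e j"
        unfolding c1 by (simp add: mult.assoc)
      also have "dn e ?Cg * dn e ?Cl = dn e (?Cl \<union> ?Cg)"
        by (subst dn_union) auto
      also have "left n J * dn j ?Cl * dn e (?Cl \<union> ?Cg) * h e j
          = left n ?J * (up ?Jg j * dn e (?Cl \<union> ?Cg)) * h e j"
        unfolding IH(1) by (simp only: mult.assoc)
      also have "\<dots> = left e ?J * up (insert e ?Jg) j"
        unfolding c2 using True sets by (subst up_insert) (auto simp: e_def mult.assoc)
      finally show ?thesis
        using IH(2) True sets unfolding e_def[symmetric] by (simp add: e_def)
    next
      case False
      have sets: "{j<..e} - J = insert e ?Cg" "{j<..e} \<inter> J = ?Jg" "{1..n} \<inter> J = ?Jl \<union> ?Jg"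
        "{1..n} \<inter> ?J = insert j ?Jl \<union> ?Jg"
        using False assms(1,2) step.hyps unfolding e_def by (auto simp: le_Suc_eq less_Suc_eq not_less le_less)
      have c1: "up (?Jl \<union> ?Jg) e * dn j ?Cg = dn j ?Cg * up (?Jl \<union> ?Jg) e"
        by (rule up_commute_dn) (use e assms step False in auto)
      have c2: "up ?Jg e * up ?Jl j = up ?Jl j * up ?Jg e"
        by (rule up_commute_up) (use e assms step False in auto)
      have "dn j ({j<..e} - J) * right e J = h j e * dn j ?Cg * up (?Jl \<union> ?Jg) e * right n J"
      proof -
        have "right e J = up (?Jl \<union> ?Jg) e * right n J"
          unfolding sets(3)[symmetric] using False by (simp add: e_def)
        moreover have "dn j ({j<..e} - J) = h j e * dn j ?Cg"
          unfolding sets(1) by (rule dn_insert) (use e in auto)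
        ultimately show ?thesis by (simp add: mult.assoc)
      qed
      also have "\<dots> = h j e * (dn j ?Cg * up (?Jl \<union> ?Jg) e) * right n J"
        by (simp add: mult.assoc)
      also have "\<dots> = h j e * up (?Jl \<union> ?Jg) e * (dn j ?Cg * right n J)"
        unfolding c1[symmetric] by (simp add: mult.assoc)
      also have "\<dots> = h j e * up (?Jl \<union> ?Jg) e * up ?Jl j * right n ?J"
        unfolding IH(2) by (simp only: mult.assoc)
      also have "up (?Jl \<union> ?Jg) e = up ?Jl e * up ?Jg e"
        by (subst up_union) auto
      also have "h j e * (up ?Jl e * up ?Jg e) * up ?Jl j = (h j e * up ?Jl e * up ?Jl j) * up ?Jg e"
        by (simp only: mult.assoc c2)
      \<comment> \<open>Here \<open>h j e\<close> ends up in the row of \<open>e\<close>, since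
        \<open>j\<close> now belongs to the set.\<close>
      also have "h j e * up ?Jl e * up ?Jl j = up ?Jl j * up ?Jl e * h j e"
        by (rule yb_up_set) (use e in auto)
      also have "up ?Jl j * up ?Jl e * h j e * up ?Jg e = up ?Jl j * (up (insert j ?Jl) e * up ?Jg e)"
        by (subst up_insert) (auto simp: mult.assoc)
      also have "up (insert j ?Jl) e * up ?Jg e = up ({1..n} \<inter> ?J) e"
        unfolding sets by (subst up_union) auto
      also have "up ?Jl j * up ({1..n} \<inter> ?J) e * right n ?J = up ?Jl j * right e ?J"
        using False e by (simp add: e_def mult.assoc)
      finally show ?thesis
        using IH(1) False e sets unfolding e_def[symmetric] by (simp add: e_def)
    qed
  qed
  then show "left n J * dn j ({1..<j} - J) = left n (insert j J) * up ({j<..n} \<inter> J) j"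
    "dn j ({j<..n} - J) * right n J = up ({1..<j} \<inter> J) j * right n (insert j J)" by auto
qed

end

section \<open>The recursion for the symmetric sum\<close>

declare One_nat_def [simp del]

section \<open>Subsets of fixed size\<close>

abbreviation (input) ksubsets :: "nat \<Rightarrow> nat \<Rightarrow> nat set set"
  where "ksubsets n k \<equiv> {I. I \<subseteq> {1..n} \<and> card I = k}"

lemma finite_ksubsets: "finite (ksubsets n k)"
  by (rule finite_subset[of _ "Pow {1..n}"]) auto

lemma ksubsetsD: "J \<in> ksubsets n k \<Longrightarrow> finite J" "J \<in> ksubsets n k \<Longrightarrow> J \<subseteq> {1..n}"
    "J \<in> ksubsets n k \<Longrightarrow> card J = k"
  by (auto intro: finite_subset)

lemma ksubsets_Suc:
  "ksubsets (Suc n) (Suc k) = ksubsets n (Suc k) \<union> insert (Suc n) ` ksubsets n k"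
proof (intro equalityI subsetI)
  fix J assume J: "J \<in> ksubsets (Suc n) (Suc k)"
  have fin: "finite J" using J by (auto intro: finite_subset)
  show "J \<in> ksubsets n (Suc k) \<union> insert (Suc n) ` ksubsets n k"
  proof (cases "Suc n \<in> J")
    case True
    then have "J = insert (Suc n) (J - {Suc n})" by auto
    moreover have "J - {Suc n} \<in> ksubsets n k"
      using J True fin by (auto simp: le_Suc_eq)
    ultimately show ?thesis by blast
  next
    case False
    then have "J \<in> ksubsets n (Suc k)" using J by (auto simp: le_Suc_eq)
    then show ?thesis by blast
  qed
next
  fix J assume "J \<in> ksubsets n (Suc k) \<union> insert (Suc n) ` ksubsets n k"
  then show "J \<in> ksubsets (Suc n) (Suc k)"
  proof
    assume "J \<in> insert (Suc n) ` ksubsets n k"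
    then obtain J' where J': "J' \<in> ksubsets n k" "J = insert (Suc n) J'" by blast
    have "finite J'" "Suc n \<notin> J'" using J'(1) by (auto intro: finite_subset)
    then show ?thesis using J' by auto
  qed auto
qed

lemma sum_ksubsets_Suc:
  "sum F (ksubsets (Suc n) (Suc k)) = sum F (ksubsets n (Suc k)) + (\<Sum>J\<in>ksubsets n k. F (insert (Suc n) J))"
proof -
  have "inj_on (insert (Suc n)) (ksubsets n k)"
  proof (rule inj_onI)
    fix A B assume "A \<in> ksubsets n k" "B \<in> ksubsets n k" "insert (Suc n) A = insert (Suc n) B"
    moreover have "Suc n \<notin> A" "Suc n \<notin> B" using calculation by auto
    ultimately show "A = B" by (simp add: insert_ident)
  qed
  moreover have "ksubsets n (Suc k) \<inter> insert (Suc n) ` ksubsets n k = {}" by auto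
  ultimately show ?thesis
    unfolding ksubsets_Suc using finite_ksubsets
    by (subst sum.union_disjoint) (auto simp: sum.reindex)
qed

section \<open>The elements \<open>x i\<close> and the recursion step\<close>

text \<open>\<open>x i\<close> stands for \<open>1 + z i\<close> and \<open>\<gamma> j\<close> for
  \<open>t * (H j - b)\<close>. The relation for \<open>z i * u i j\<close> becomes
  \<open>x_left\<close>; the one for \<open>z j * u i j\<close> enters through
  \<open>xx_h\<close>.\<close>

locale dunkl_ring = three_term +
  fixes x \<gamma> :: "nat \<Rightarrow> 'a"
  assumes gam_central: "\<gamma> j * y = y * \<gamma> j"
    and x_comm: "{i, j} \<subseteq> {1..N} \<Longrightarrow> x i * x j = x j * x i"
    and x_h: "{i, j, k} \<subseteq> {1..N} \<Longrightarrow> i \<noteq> j \<Longrightarrow> k \<notin> {i, j} \<Longrightarrow> x k * h i j = h i j * x k"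
    and xx_h: "{i, j} \<subseteq> {1..N} \<Longrightarrow> i \<noteq> j \<Longrightarrow> x i * x j * h i j = h i j * (x i * x j)"
    and x_left: "1 \<le> i \<Longrightarrow> i < j \<Longrightarrow> j \<le> N \<Longrightarrow> x i * h i j = s * x i + (h i j - 1) * x j + \<gamma> j"
begin

definition x_prod :: "nat set \<Rightarrow> 'a"
  where "x_prod J = prod_list (map x (sorted_list_of_set J))"

lemma x_prod_empty [simp]: "x_prod {} = 1"
  by (simp add: x_prod_def)

lemma x_prod_insert:
  assumes "finite J" "insert j J \<subseteq> {1..N}" "j \<notin> J"
  shows "x_prod (insert j J) = x_prod J * x j"
proof -
  have "x_prod (insert j J) = prod_list (map x (sorted_list_of_set J @ [j]))"
    unfolding x_prod_def
  proof (rule prod_list_mset_eq)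
    show "mset (map x (sorted_list_of_set (insert j J))) = mset (map x (sorted_list_of_set J @ [j]))"
      using assms by (simp del: sorted_list_of_set_insert_remove)
    have "set (map x (sorted_list_of_set (insert j J))) = x ` insert j J"
      using assms(1) by (simp only: set_map set_sorted_list_of_set finite_insert)
    then show "a * b = b * a" if "a \<in> set (map x (sorted_list_of_set (insert j J)))"
      "b \<in> set (map x (sorted_list_of_set (insert j J)))" for a b
      using that assms(2) by (auto intro!: x_comm)
  qed
  then show ?thesis by (simp add: x_prod_def)
qed

lemma x_prod_comm_out:
  assumes "J \<subseteq> {1..N}" "{i, j} \<subseteq> {1..N}" "i \<noteq> j" "i \<notin> J" "j \<notin> J"
  shows "h i j * x_prod J = x_prod J * h i j"
  unfolding x_prod_def using assms finite_subset[OF assms(1)]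
  by (intro commute_prod_list) (auto intro!: x_h[symmetric])

text \<open>\<open>h i j\<close> is known to commute with the product \<open>x i * x j\<close> but
  not with its factors, so these two are first brought together at the end of
  \<open>x_prod J\<close>.\<close>

lemma x_prod_comm_in:
  assumes "J \<subseteq> {1..N}" "i \<in> J" "j \<in> J" "i \<noteq> j"
  shows "h i j * x_prod J = x_prod J * h i j"
proof -
  have fin: "finite J" using assms(1) finite_subset by blast
  let ?J = "J - {i} - {j}"
  have J: "J = insert j (insert i ?J)" using assms by auto
  have "x_prod (insert i ?J) = x_prod ?J * x i" using fin assms by (intro x_prod_insert) auto
  moreover have "x_prod J = x_prod (insert i ?J) * x j"
    using fin assms by (subst J, intro x_prod_insert) auto
  ultimately have "x_prod J = x_prod ?J * (x i * x j)" by (simp add: mult.assoc)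
  moreover have "h i j * x_prod ?J = x_prod ?J * h i j"
    by (rule x_prod_comm_out) (use assms in auto)
  moreover have "h i j * (x i * x j) = (x i * x j) * h i j"
    using xx_h[of i j] assms by (auto simp: subset_iff)
  ultimately show ?thesis by (metis commute_mult)
qed

text \<open>\<open>up_sum_one\<close> on \<open>insert (Suc n) J\<close> isolates
  \<open>up J (Suc n)\<close> as a boundary term, and \<open>h_sum\<close> reverses the indices in
  the rest. What results is linear in the \<open>h j (Suc n)\<close>, so that
  \<open>exchange_sum\<close> applies.\<close>

lemma up_expand:
  assumes "J \<subseteq> {1..n}" "Suc n \<le> N"
  shows "up J (Suc n) = 1 - qint s (card J) + up_sum (\<lambda>j. h j (Suc n)) J"
proof -
  have J: "finite J" "\<And>i. i \<in> J \<Longrightarrow> i < Suc n" "Suc n \<notin> J"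
    using assms(1) finite_subset by (auto simp: less_Suc_eq_le)
  have "up_sum (\<lambda>j. h (Suc n) j) J = up_sum (\<lambda>j. (1 + s) * 1 - h j (Suc n)) J"
  proof (rule up_sum_cong)
    fix j assume "j \<in> J"
    then have "h j (Suc n) + h (Suc n) j = 1 + s"
      using assms by (intro h_sum) auto
    then show "h (Suc n) j = (1 + s) * 1 - h j (Suc n)" by (simp add: algebra_simps)
  qed
  also have "\<dots> = (1 + s) * qint s (card J) - up_sum (\<lambda>j. h j (Suc n)) J"
  proof -
    have "up_sum (\<lambda>j. (1 + s) * 1) J = (1 + s) * up_sum (\<lambda>j. 1) J"
      by (rule up_sum_left) (use J in \<open>auto simp: algebra_simps s_central\<close>)
    moreover have "up_sum (\<lambda>j. 1) J = qint s (card J)" using assms by (intro up_sum_one J(1)) auto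
    ultimately show ?thesis by (simp only: up_sum_diff)
  qed
  finally have 1: "up_sum (\<lambda>j. h (Suc n) j) J = (1 + s) * qint s (card J) - up_sum (\<lambda>j. h j (Suc n)) J" .
  have "up_sum (\<lambda>j. 1) (insert (Suc n) J) = qint s (card (insert (Suc n) J))"
    by (rule up_sum_one) (use assms J in auto)
  then have "up_sum (\<lambda>j. h (Suc n) j) J + up J (Suc n) = qint s (Suc (card J))"
    using up_sum_insert[OF J(1,2), of "\<lambda>_. 1"] J by simp
  then show ?thesis unfolding 1 qint_Suc' by (simp add: algebra_simps)
qed

text \<open>The recursion for \<open>k = 1\<close> on \<open>insert (Suc n) C\<close>. By
  \<open>dn_sum_one\<close>, summing \<open>(h j (Suc n) - 1) * x (Suc n)\<close> gives a difference
  of two consecutive q-integers and a term that cancels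
  \<open>dn (Suc n) C * x (Suc n)\<close>.\<close>

lemma dn_sum_x:
  assumes "C \<subseteq> {1..n}" "Suc n \<le> N"
  shows "dn_sum (\<lambda>j. x j * h j (Suc n)) C + dn (Suc n) C * x (Suc n)
    = s * dn_sum x C + s ^ card C * x (Suc n) + \<gamma> (Suc n) * qint s (card C)"
proof -
  have C: "finite C" "\<And>i. i \<in> C \<Longrightarrow> i < Suc n" "Suc n \<notin> C" "C \<subseteq> {1..N}"
    using assms finite_subset by (auto simp: less_Suc_eq_le)
  have "dn_sum (\<lambda>j. x j * h j (Suc n)) C
      = dn_sum (\<lambda>j. s * x j + (h j (Suc n) - 1) * x (Suc n) + \<gamma> (Suc n) * 1) C"
    by (rule dn_sum_cong) (use assms in \<open>auto intro!: x_left\<close>)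
  also have "\<dots> = s * dn_sum x C + (dn_sum (\<lambda>j. h j (Suc n)) C - dn_sum (\<lambda>j. 1) C) * x (Suc n) + \<gamma> (Suc n) * dn_sum (\<lambda>j. 1) C"
  proof -
    have "dn_sum (\<lambda>j. s * x j) C = s * dn_sum x C"
      by (rule dn_sum_left) (use C s_central in auto)
    moreover have "dn_sum (\<lambda>j. \<gamma> (Suc n) * 1) C = \<gamma> (Suc n) * dn_sum (\<lambda>j. 1) C"
      by (rule dn_sum_left) (use C gam_central in auto)
    moreover have "dn_sum (\<lambda>j. (h j (Suc n) - 1) * x (Suc n)) C = dn_sum (\<lambda>j. h j (Suc n) - 1) C * x (Suc n)"
      by (rule dn_sum_right) (use C assms(2) in \<open>auto intro!: x_h\<close>)
    ultimately show ?thesis by (simp only: dn_sum_add dn_sum_diff)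
  qed
  also have "dn_sum (\<lambda>j. h j (Suc n)) C = dn_sum (\<lambda>j. 1) (insert (Suc n) C) - dn (Suc n) C"
    using dn_sum_insert[OF C(1,2), of "\<lambda>_. 1"] by simp
  also have "dn_sum (\<lambda>j. 1) (insert (Suc n) C) = qint s (Suc (card C))"
    using C assms by (subst dn_sum_one) auto
  also have "dn_sum (\<lambda>j. 1) C = qint s (card C)"
    using C assms by (subst dn_sum_one) auto
  finally show ?thesis by (simp add: algebra_simps)
qed

text \<open>Pairs \<open>(J, j)\<close> with \<open>j\<close> outside \<open>J\<close> correspond to
  pairs \<open>(insert j J, j)\<close>, and corresponding terms agree by \<open>exchange\<close>.
  The recursion uses it with \<open>g j = h j (Suc n)\<close> in one direction and with
  \<open>g j = 1\<close> in the other.\<close>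

lemma exchange_sum:
  assumes "n \<le> N"
  shows "(\<Sum>J\<in>ksubsets n k. left n J * x_prod J * dn_sum (\<lambda>j. x j * g j) ({1..n} - J) * right n J)
    = (\<Sum>J\<in>ksubsets n (Suc k). left n J * x_prod J * up_sum g J * right n J)"
proof -
  let ?A = "\<lambda>J j. left n J * x_prod J * (dn j ({1..<j} - J) * (x j * g j) * dn j ({j<..n} - J)) * right n J"
  let ?B = "\<lambda>J j. left n J * x_prod J * (up ({j<..n} \<inter> J) j * g j * up ({1..<j} \<inter> J) j) * right n J"
  have AB: "?A J j = ?B (insert j J) j" if J: "J \<subseteq> {1..n}" and j: "j \<in> {1..n} - J" for J j
  proof -
    have fin: "finite J" using J finite_subset by blast
    \<comment> \<open>Two commutations with different reasons: in \<open>c1\<close> both indices of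
      each \<open>h\<close> lie outside \<open>J\<close>, in \<open>c2\<close> both lie in
      \<open>insert j J\<close>.\<close>
    have c1: "x_prod J * dn j ({1..<j} - J) = dn j ({1..<j} - J) * x_prod J"
      by (rule commute_dn) (use J j assms in \<open>auto intro!: x_prod_comm_out[symmetric]\<close>)
    have c2: "x_prod (insert j J) * up ({j<..n} \<inter> J) j = up ({j<..n} \<inter> J) j * x_prod (insert j J)"
      by (rule commute_up) (use J j assms in \<open>auto intro!: x_prod_comm_in[symmetric]\<close>)
    have xi: "x_prod (insert j J) = x_prod J * x j"
      by (rule x_prod_insert) (use fin J j assms in auto)
    have "?A J j = left n J * (x_prod J * dn j ({1..<j} - J)) * x j * g j * (dn j ({j<..n} - J) * right n J)"
      by (simp only: mult.assoc)
    also have "\<dots> = (left n J * dn j ({1..<j} - J)) * (x_prod J * x j) * g j * (dn j ({j<..n} - J) * right n J)"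
      unfolding c1 by (simp only: mult.assoc)
    also have "left n J * dn j ({1..<j} - J) = left n (insert j J) * up ({j<..n} \<inter> J) j"
      by (rule left_exchange) (use j assms in auto)
    also have "dn j ({j<..n} - J) * right n J = up ({1..<j} \<inter> J) j * right n (insert j J)"
      by (rule right_exchange) (use j assms in auto)
    also have "left n (insert j J) * up ({j<..n} \<inter> J) j * (x_prod J * x j) * g j
        * (up ({1..<j} \<inter> J) j * right n (insert j J))
      = left n (insert j J) * (up ({j<..n} \<inter> J) j * x_prod (insert j J)) * g j
        * (up ({1..<j} \<inter> J) j * right n (insert j J))"
      unfolding xi by (simp only: mult.assoc)
    also have "\<dots> = left n (insert j J) * x_prod (insert j J)
        * (up ({j<..n} \<inter> J) j * g j * up ({1..<j} \<inter> J) j) * right n (insert j J)"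
      unfolding c2[symmetric] by (simp only: mult.assoc)
    also have "{j<..n} \<inter> J = {j<..n} \<inter> insert j J" by auto
    also have "{1..<j} \<inter> J = {1..<j} \<inter> insert j J" by auto
    finally show ?thesis .
  qed
  have "(\<Sum>J\<in>ksubsets n k. left n J * x_prod J * dn_sum (\<lambda>j. x j * g j) ({1..n} - J) * right n J)
      = (\<Sum>J\<in>ksubsets n k. \<Sum>j\<in>{1..n} - J. ?A J j)"
  proof (rule sum.cong[OF refl])
    fix J assume "J \<in> ksubsets n k"
    have "{i \<in> {1..n} - J. i < j} = {1..<j} - J" "{i \<in> {1..n} - J. j < i} = {j<..n} - J"
      if "j \<in> {1..n}" for j using that by auto
    then have "dn_sum (\<lambda>j. x j * g j) ({1..n} - J)
      = (\<Sum>j\<in>{1..n} - J. dn j ({1..<j} - J) * (x j * g j) * dn j ({j<..n} - J))"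
      unfolding dn_sum_def by (intro sum.cong) simp_all
    then show "left n J * x_prod J * dn_sum (\<lambda>j. x j * g j) ({1..n} - J) * right n J = (\<Sum>j\<in>{1..n} - J. ?A J j)"
      by (simp add: sum_distrib_left sum_distrib_right)
  qed
  also have "\<dots> = (\<Sum>(J, j)\<in>Sigma (ksubsets n k) (\<lambda>J. {1..n} - J). ?A J j)"
    by (rule sum.Sigma) (auto simp: finite_ksubsets)
  also have "\<dots> = (\<Sum>(J, j)\<in>Sigma (ksubsets n (Suc k)) (\<lambda>J. J). ?B J j)"
  proof (rule sum.reindex_bij_witness[where i = "\<lambda>(J, j). (J - {j}, j)" and j = "\<lambda>(J, j). (insert j J, j)"])
    fix a assume "a \<in> Sigma (ksubsets n k) (\<lambda>J. {1..n} - J)"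
    then obtain J j where a: "a = (J, j)" "J \<in> ksubsets n k" "j \<in> {1..n} - J" by auto
    have "finite J" using a(2) by (rule ksubsetsD)
    then show "(case case a of (J, j) \<Rightarrow> (insert j J, j) of (J, j) \<Rightarrow> (J - {j}, j)) = a"
      "(case a of (J, j) \<Rightarrow> (insert j J, j)) \<in> Sigma (ksubsets n (Suc k)) (\<lambda>J. J)"
      using a by auto
    show "(case case a of (J, j) \<Rightarrow> (insert j J, j) of (J, j) \<Rightarrow> ?B J j) = (case a of (J, j) \<Rightarrow> ?A J j)"
      unfolding a(1) using a(2,3) AB[of J j] by simp
  next
    fix b assume "b \<in> Sigma (ksubsets n (Suc k)) (\<lambda>J. J)"
    then obtain J j where b: "b = (J, j)" "J \<in> ksubsets n (Suc k)" "j \<in> J" by auto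
    have "finite J" using b(2) by (rule ksubsetsD)
    then show "(case case b of (J, j) \<Rightarrow> (J - {j}, j) of (J, j) \<Rightarrow> (insert j J, j)) = b"
      "(case b of (J, j) \<Rightarrow> (J - {j}, j)) \<in> Sigma (ksubsets n k) (\<lambda>J. {1..n} - J)"
      using b by auto
  qed
  also have "\<dots> = (\<Sum>J\<in>ksubsets n (Suc k). \<Sum>j\<in>J. ?B J j)"
    by (rule sum.Sigma[symmetric]) (auto simp: finite_ksubsets intro: finite_subset)
  also have "\<dots> = (\<Sum>J\<in>ksubsets n (Suc k). left n J * x_prod J * up_sum g J * right n J)"
  proof (rule sum.cong[OF refl])
    fix J assume "J \<in> ksubsets n (Suc k)"
    then have "{i \<in> J. i < j} = {1..<j} \<inter> J" "{i \<in> J. j < i} = {j<..n} \<inter> J"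
      if "j \<in> J" for j using that by auto
    then have "up_sum g J = (\<Sum>j\<in>J. up ({j<..n} \<inter> J) j * g j * up ({1..<j} \<inter> J) j)"
      unfolding up_sum_def by (intro sum.cong) simp_all
    then show "(\<Sum>j\<in>J. ?B J j) = left n J * x_prod J * up_sum g J * right n J"
      by (simp add: sum_distrib_left sum_distrib_right)
  qed
  finally show ?thesis .
qed

text \<open>The sum \<open>E\<^sub>k(n)\<close> of the overview, free of inverses.\<close>

definition dunkl_sum :: "nat \<Rightarrow> nat \<Rightarrow> 'a"
  where "dunkl_sum n k = (\<Sum>J\<in>ksubsets n k. left n J * x_prod J * right n J)"

text \<open>The recursion of the overview with both parameters raised by one, which leaves
  \<open>n - k\<close> unchanged. For \<open>k > n\<close> this difference is truncated, but then
  \<open>dunkl_sum n k\<close> is an empty sum.\<close>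

lemma dunkl_sum_Suc:
  assumes "Suc n \<le> N"
  shows "dunkl_sum (Suc n) (Suc k) = s ^ Suc k * dunkl_sum n (Suc k)
    + dunkl_sum n k * (x (Suc n) * s ^ (n - k) + \<gamma> (Suc n) * qint s (n - k))"
proof -
  let ?e = "Suc n" and ?q = "qint s (Suc k)"
  have n: "n \<le> N" using assms by simp
  have notin: "?e \<notin> J" "{1..n} \<inter> J = J" if "J \<in> ksubsets n k'" for J k' using that by auto
  have xe: "x ?e * right n J = right n J * x ?e" for J
    by (rule commute_right) (use assms in \<open>auto intro!: x_h\<close>)
  have pw: "s ^ m * y = y * s ^ m" for m y
    by (rule power_commuting_commutes[OF s_central])
  \<comment> \<open>Sets without \<open>Suc n\<close> gain a row of \<open>right\<close>; sets with
    it gain a row of \<open>left\<close>, moved past \<open>x_prod J\<close>, and the factor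
    \<open>x (Suc n)\<close>.\<close>
  have "dunkl_sum ?e (Suc k) = (\<Sum>J\<in>ksubsets n (Suc k). left n J * x_prod J * up J ?e * right n J)
      + (\<Sum>J\<in>ksubsets n k. left n J * x_prod J * (dn ?e ({1..n} - J) * x ?e) * right n J)"
    unfolding dunkl_sum_def sum_ksubsets_Suc
  proof (intro arg_cong2[of _ _ _ _ "(+)"] sum.cong refl)
    fix J assume J: "J \<in> ksubsets n (Suc k)"
    show "left ?e J * x_prod J * right ?e J = left n J * x_prod J * up J ?e * right n J"
      using notin[OF J] by (simp add: mult.assoc)
  next
    fix J assume J: "J \<in> ksubsets n k"
    have c: "x_prod J * dn ?e ({1..n} - J) = dn ?e ({1..n} - J) * x_prod J"
      by (rule commute_dn) (use J assms in \<open>auto intro!: x_prod_comm_out[symmetric]\<close>)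
    have sets: "{1..n} - insert ?e J = {1..n} - J" by auto
    have l: "left n (insert ?e J) = left n J" and r: "right n (insert ?e J) = right n J"
      by (rule left_cong right_cong; auto)+
    have "x_prod (insert ?e J) = x_prod J * x ?e"
      by (rule x_prod_insert) (use J assms in \<open>auto intro: finite_subset\<close>)
    then have "left ?e (insert ?e J) * x_prod (insert ?e J) * right ?e (insert ?e J)
      = left n J * (dn ?e ({1..n} - J) * x_prod J) * x ?e * right n J"
      by (simp add: l r sets mult.assoc)
    also have "\<dots> = left n J * x_prod J * (dn ?e ({1..n} - J) * x ?e) * right n J"
      unfolding c[symmetric] by (simp only: mult.assoc)
    finally show "left ?e (insert ?e J) * x_prod (insert ?e J) * right ?e (insert ?e J) = \<dots>" .
  qed
  also have "(\<Sum>J\<in>ksubsets n (Suc k). left n J * x_prod J * up J ?e * right n J)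
      = (\<Sum>J\<in>ksubsets n (Suc k). (1 - ?q) * (left n J * x_prod J * right n J)
          + left n J * x_prod J * up_sum (\<lambda>j. h j ?e) J * right n J)"
  proof (rule sum.cong[OF refl])
    fix J assume J: "J \<in> ksubsets n (Suc k)"
    then have "up J ?e = 1 - ?q + up_sum (\<lambda>j. h j ?e) J"
      using up_expand[of J n] assms by (simp del: qint_simps)
    moreover have "left n J * x_prod J * ?q * right n J = ?q * (left n J * x_prod J * right n J)"
      by (simp only: mult.assoc qint_central)
    ultimately show "left n J * x_prod J * up J ?e * right n J
      = (1 - ?q) * (left n J * x_prod J * right n J) + left n J * x_prod J * up_sum (\<lambda>j. h j ?e) J * right n J"
      by (simp only: distrib_left distrib_right left_diff_distrib right_diff_distrib
          mult_1_left mult_1_right)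
  qed
  also have "\<dots> = (1 - ?q) * dunkl_sum n (Suc k)
      + (\<Sum>J\<in>ksubsets n (Suc k). left n J * x_prod J * up_sum (\<lambda>j. h j ?e) J * right n J)"
    by (simp only: dunkl_sum_def sum.distrib sum_distrib_left)
  \<comment> \<open>The exchange brings the linear terms to the same sets \<open>J\<close> as the
    second sum, so that \<open>dn_sum_x\<close> applies to both together.\<close>
  also have "(\<Sum>J\<in>ksubsets n (Suc k). left n J * x_prod J * up_sum (\<lambda>j. h j ?e) J * right n J)
      = (\<Sum>J\<in>ksubsets n k. left n J * x_prod J * dn_sum (\<lambda>j. x j * h j ?e) ({1..n} - J) * right n J)"
    by (rule exchange_sum[OF n, symmetric])
  also have "(1 - ?q) * dunkl_sum n (Suc k)
      + (\<Sum>J\<in>ksubsets n k. left n J * x_prod J * dn_sum (\<lambda>j. x j * h j ?e) ({1..n} - J) * right n J)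
      + (\<Sum>J\<in>ksubsets n k. left n J * x_prod J * (dn ?e ({1..n} - J) * x ?e) * right n J)
    = (1 - ?q) * dunkl_sum n (Suc k)
      + (\<Sum>J\<in>ksubsets n k. s * (left n J * x_prod J * dn_sum (\<lambda>j. x j * 1) ({1..n} - J) * right n J)
        + left n J * x_prod J * right n J * (x ?e * s ^ (n - k) + \<gamma> ?e * qint s (n - k)))"
  proof -
    have "left n J * x_prod J * dn_sum (\<lambda>j. x j * h j ?e) ({1..n} - J) * right n J
        + left n J * x_prod J * (dn ?e ({1..n} - J) * x ?e) * right n J
      = s * (left n J * x_prod J * dn_sum (\<lambda>j. x j * 1) ({1..n} - J) * right n J)
        + left n J * x_prod J * right n J * (x ?e * s ^ (n - k) + \<gamma> ?e * qint s (n - k))"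
      if J: "J \<in> ksubsets n k" for J
    proof -
      have card: "card ({1..n} - J) = n - k"
        using ksubsetsD[OF J] by (simp add: card_Diff_subset)
      have "left n J * x_prod J * dn_sum (\<lambda>j. x j * h j ?e) ({1..n} - J) * right n J
          + left n J * x_prod J * (dn ?e ({1..n} - J) * x ?e) * right n J
        = left n J * x_prod J * (dn_sum (\<lambda>j. x j * h j ?e) ({1..n} - J) + dn ?e ({1..n} - J) * x ?e) * right n J"
        by (simp only: distrib_left distrib_right)
      also have "dn_sum (\<lambda>j. x j * h j ?e) ({1..n} - J) + dn ?e ({1..n} - J) * x ?e
        = s * dn_sum x ({1..n} - J) + s ^ (n - k) * x ?e + \<gamma> ?e * qint s (n - k)"
        using dn_sum_x[of "{1..n} - J" n] assms card by simp
      also have "left n J * x_prod J * \<dots> * right n J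
        = left n J * x_prod J * (s * dn_sum x ({1..n} - J)) * right n J
          + left n J * x_prod J * (s ^ (n - k) * (x ?e * right n J))
          + left n J * x_prod J * (\<gamma> ?e * qint s (n - k) * right n J)"
        by (simp only: distrib_left distrib_right mult.assoc)
      also have "left n J * x_prod J * (s * dn_sum x ({1..n} - J)) * right n J
        = s * (left n J * x_prod J * dn_sum x ({1..n} - J) * right n J)"
        by (simp only: mult.assoc s_central)
      also have "s ^ (n - k) * (x ?e * right n J) = right n J * (x ?e * s ^ (n - k))"
        unfolding xe pw by (simp only: mult.assoc)
      also have "\<gamma> ?e * qint s (n - k) * right n J = right n J * (\<gamma> ?e * qint s (n - k))"
        by (rule commute_mult[OF gam_central[symmetric] qint_central[symmetric], symmetric])
      finally show ?thesis by (simp add: distrib_left mult.assoc)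
    qed
    then show ?thesis unfolding add.assoc sum.distrib[symmetric]
      by (intro arg_cong[of _ _ "(+) _"] sum.cong refl) blast
  qed
  also have "\<dots> = (1 - ?q) * dunkl_sum n (Suc k)
      + s * (\<Sum>J\<in>ksubsets n k. left n J * x_prod J * dn_sum (\<lambda>j. x j * 1) ({1..n} - J) * right n J)
      + dunkl_sum n k * (x ?e * s ^ (n - k) + \<gamma> ?e * qint s (n - k))"
    by (simp only: dunkl_sum_def sum.distrib sum_distrib_left[of s] sum_distrib_right add.assoc)
  \<comment> \<open>Exchanging back with \<open>g j = 1\<close> leads to \<open>up_sum_one\<close>,
    hence to a multiple of \<open>dunkl_sum n (Suc k)\<close>.\<close>
  also have "(\<Sum>J\<in>ksubsets n k. left n J * x_prod J * dn_sum (\<lambda>j. x j * 1) ({1..n} - J) * right n J)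
      = (\<Sum>J\<in>ksubsets n (Suc k). left n J * x_prod J * up_sum (\<lambda>j. 1) J * right n J)"
    by (rule exchange_sum[OF n])
  also have "\<dots> = (\<Sum>J\<in>ksubsets n (Suc k). ?q * (left n J * x_prod J * right n J))"
  proof (rule sum.cong[OF refl])
    fix J assume J: "J \<in> ksubsets n (Suc k)"
    have "up_sum (\<lambda>j. 1) J = ?q" using up_sum_one[of J] ksubsetsD[OF J] n by force
    then show "left n J * x_prod J * up_sum (\<lambda>j. 1) J * right n J = ?q * (left n J * x_prod J * right n J)"
      by (simp only: mult.assoc qint_central)
  qed
  also have "\<dots> = ?q * dunkl_sum n (Suc k)"
    by (simp only: dunkl_sum_def sum_distrib_left)
  also have "(1 - ?q) * dunkl_sum n (Suc k) + s * (?q * dunkl_sum n (Suc k)) = (1 + s * ?q - ?q) * dunkl_sum n (Suc k)"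
    by (simp add: algebra_simps del: qint_simps)
  \<comment> \<open>Two expressions for \<open>qint s (Suc (Suc k))\<close> are compared.\<close>
  also have "1 + s * ?q - ?q = s ^ Suc k"
    by (metis add_diff_cancel_left' qint_Suc' qint_simps(2))
  finally show ?thesis .
qed

lemma dunkl_sum_0 [simp]: "dunkl_sum n 0 = 1"
proof -
  have "ksubsets n 0 = {{}}" 
    by (auto simp: card_eq_0_iff dest: finite_subset[of _ "{1..n}"])
  moreover have "left n {} = 1" "right n {} = 1" by (induction n) auto
  ultimately show ?thesis by (simp add: dunkl_sum_def)
qed

lemma dunkl_sum_0_Suc [simp]: "dunkl_sum 0 (Suc k) = 0"
proof -
  have "ksubsets 0 (Suc k) = {}" by auto
  then show ?thesis unfolding dunkl_sum_def by (simp only: sum.empty)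
qed

end

section \<open>Evaluation of the sum and of products of Dunkl elements\<close>

abbreviation (input) increasing_lists :: "nat \<Rightarrow> nat \<Rightarrow> nat list set"
  where "increasing_lists n k \<equiv> {l. length l = k \<and> set l \<subseteq> {1..n} \<and> sorted_wrt (<) l}"

lemma finite_increasing_lists: "finite (increasing_lists n k)"
  by (rule finite_subset[OF _ finite_lists_length_eq[of "{1..n}" k]]) auto

lemma increasing_lists_Suc: "increasing_lists (Suc n) (Suc k) = increasing_lists n (Suc k) \<union> (\<lambda>l. l @ [Suc n]) ` increasing_lists n k"
proof (intro equalityI subsetI)
  fix l assume l: "l \<in> increasing_lists (Suc n) (Suc k)"
  then obtain l' a where l': "l = l' @ [a]" by (cases l rule: rev_exhaust) auto
  then have l'a: "\<forall>b\<in>set l'. 1 \<le> b \<and> b < a" "length l' = k" "sorted_wrt (<) l'" "1 \<le> a" "a \<le> Suc n"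
    using l by (auto simp: sorted_wrt_append)
  show "l \<in> increasing_lists n (Suc k) \<union> (\<lambda>l. l @ [Suc n]) ` increasing_lists n k"
  proof (cases "a = Suc n")
    case True
    then have "l' \<in> increasing_lists n k" using l'a by (auto simp: less_Suc_eq_le)
    then show ?thesis using l' True by blast
  next
    case False
    then have "l \<in> increasing_lists n (Suc k)" using l l' l'a by force
    then show ?thesis by blast
  qed
next
  fix l assume "l \<in> increasing_lists n (Suc k) \<union> (\<lambda>l. l @ [Suc n]) ` increasing_lists n k"
  then show "l \<in> increasing_lists (Suc n) (Suc k)"
    by (auto simp: sorted_wrt_append less_Suc_eq_le subset_iff)
qed

lemma sum_increasing_lists_Suc:
  "sum F (increasing_lists (Suc n) (Suc k)) = sum F (increasing_lists n (Suc k)) + (\<Sum>l\<in>increasing_lists n k. F (l @ [Suc n]))"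
proof -
  have "inj_on (\<lambda>l. l @ [Suc n]) (increasing_lists n k)" by (rule inj_onI) auto
  moreover have "increasing_lists n (Suc k) \<inter> (\<lambda>l. l @ [Suc n]) ` increasing_lists n k = {}" by auto
  ultimately show ?thesis
    unfolding increasing_lists_Suc using finite_increasing_lists
    by (subst sum.union_disjoint) (auto simp: sum.reindex)
qed

text \<open>Entries grow by at least one per position. For \<open>i = a - 1\<close> this shows that
  the exponent \<open>n + a - (k + l ! (a - 1))\<close> is a genuine difference.\<close>

lemma increasing_list_bound:
  assumes "sorted_wrt (<) l" "set l \<subseteq> {1..n}" "i < length l"
  shows "l ! i + (length l - Suc i) \<le> n"
  using assms
proof (induction "length l - Suc i" arbitrary: i)
  case 0
  then have "l ! i \<in> {1..n}" using nth_mem by blast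
  then show ?case using 0 by simp
next
  case (Suc d)
  then have "l ! Suc i + (length l - Suc (Suc i)) \<le> n" by (intro Suc.hyps(1)) auto
  moreover have "l ! i < l ! Suc i"
    using sorted_wrt_nth_less[OF Suc.prems(1), of i "Suc i"] Suc.hyps(2) by simp
  ultimately show ?case using Suc.hyps(2) by linarith
qed

context dunkl_ring begin

definition factor :: "nat \<Rightarrow> nat \<Rightarrow> 'a"
  where "factor i m = x i * s ^ m + \<gamma> i * qint s m"

text \<open>A summand of the right-hand side, up to \<open>factor_eq\<close>. The numbers
  \<open>a\<close> count from 1, list positions from 0.\<close>

definition list_term :: "nat \<Rightarrow> nat \<Rightarrow> nat list \<Rightarrow> 'a"
  where "list_term n k l = prod_list (map (\<lambda>a. s ^ (n + a - (k + l ! (a - 1))) * factor (l ! (a - 1)) (l ! (a - 1) - a)) [1..<Suc k])"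

lemma prod_list_power_central:
  "prod_list (map (\<lambda>a. s * f a) as) = s ^ length as * prod_list (map f as)"
proof (induction as)
  case (Cons a as)
  have "f a * s ^ length as = s ^ length as * f a"
    by (rule power_commuting_commutes[OF s_central, symmetric])
  then have "s * f a * (s ^ length as * prod_list (map f as)) = s * s ^ length as * f a * prod_list (map f as)"
    by (simp add: mult.assoc) (simp flip: mult.assoc)
  then show ?case using Cons by (simp add: mult.assoc)
qed simp

text \<open>Both sides obey the recursion \<open>dunkl_sum_Suc\<close>: the facts \<open>1\<close>
  and \<open>2\<close> below treat the lists without and with the last entry
  \<open>Suc n\<close>.\<close>

lemma dunkl_sum_eq: "n \<le> N \<Longrightarrow> dunkl_sum n k = (\<Sum>l\<in>increasing_lists n k. list_term n k l)"
proof (induction n arbitrary: k)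
  case 0
  have "increasing_lists 0 (Suc k) = {}" for k by auto
  moreover have "increasing_lists 0 0 = {[]}" by auto
  ultimately show ?case by (cases k) (simp_all only: dunkl_sum_0 dunkl_sum_0_Suc, simp_all add: list_term_def)
next
  case (Suc n)
  show ?case
  proof (cases k)
    case 0
    have "increasing_lists (Suc n) 0 = {[]}" by auto
    then show ?thesis unfolding 0 dunkl_sum_0 by (simp add: list_term_def)
  next
    case k: (Suc k')
    \<comment> \<open>All \<open>Suc k'\<close> exponents of \<open>s\<close> in front of the
      factors rise by one; \<open>increasing_list_bound\<close> excludes truncation.\<close>
    have 1: "list_term (Suc n) (Suc k') l = s ^ Suc k' * list_term n (Suc k') l" if l: "l \<in> increasing_lists n (Suc k')" for l
    proof -
      have "s ^ (Suc n + a - (Suc k' + l ! (a - 1))) = s * s ^ (n + a - (Suc k' + l ! (a - 1)))"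
        if "a \<in> set [1..<Suc (Suc k')]" for a
      proof -
        have "l ! (a - 1) + (length l - Suc (a - 1)) \<le> n"
          by (rule increasing_list_bound) (use l that in auto)
        then have "Suc n + a - (Suc k' + l ! (a - 1)) = Suc (n + a - (Suc k' + l ! (a - 1)))"
          using l that by auto
        then show ?thesis by simp
      qed
      then have "list_term (Suc n) (Suc k') l = prod_list (map (\<lambda>a. s *
          (s ^ (n + a - (Suc k' + l ! (a - 1))) * factor (l ! (a - 1)) (l ! (a - 1) - a))) [1..<Suc (Suc k')])"
        unfolding list_term_def by (intro arg_cong[of _ _ prod_list] map_cong refl) (simp only: mult.assoc)
      then show ?thesis unfolding prod_list_power_central list_term_def by (simp del: upt_Suc)
    qed
    \<comment> \<open>As \<open>n\<close> and \<open>k'\<close> grow together, the earlier exponents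
      stay the same; the new last one is 0.\<close>
    have 2: "list_term (Suc n) (Suc k') (l @ [Suc n]) = list_term n k' l * factor (Suc n) (n - k')"
      if l: "l \<in> increasing_lists n k'" for l
    proof -
      let ?F = "\<lambda>a. s ^ (Suc n + a - (Suc k' + (l @ [Suc n]) ! (a - 1))) *
        factor ((l @ [Suc n]) ! (a - 1)) ((l @ [Suc n]) ! (a - 1) - a)"
      have "list_term (Suc n) (Suc k') (l @ [Suc n]) = prod_list (map ?F [1..<Suc k']) * ?F (Suc k')"
        unfolding list_term_def by (subst upt_Suc) (simp del: upt_Suc)
      also have "map ?F [1..<Suc k']
        = map (\<lambda>a. s ^ (n + a - (k' + l ! (a - 1))) * factor (l ! (a - 1)) (l ! (a - 1) - a)) [1..<Suc k']"
        by (intro map_cong refl) (use l in \<open>auto simp: nth_append\<close>)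
      also have "?F (Suc k') = factor (Suc n) (n - k')"
        using l by (simp add: nth_append)
      finally show ?thesis unfolding list_term_def .
    qed
    have "dunkl_sum (Suc n) k = s ^ Suc k' * (\<Sum>l\<in>increasing_lists n (Suc k'). list_term n (Suc k') l)
        + (\<Sum>l\<in>increasing_lists n k'. list_term n k' l) * factor (Suc n) (n - k')"
      unfolding k factor_def using Suc by (simp add: dunkl_sum_Suc)
    also have "\<dots> = (\<Sum>l\<in>increasing_lists n (Suc k'). list_term (Suc n) (Suc k') l)
        + (\<Sum>l\<in>increasing_lists n k'. list_term (Suc n) (Suc k') (l @ [Suc n]))"
      unfolding sum_distrib_left sum_distrib_right
      by (intro arg_cong2[of _ _ _ _ "(+)"] sum.cong refl) (simp_all only: 1 2)
    finally show ?thesis unfolding k sum_increasing_lists_Suc .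
  qed
qed

end

section \<open>Products of Dunkl elements\<close>

text \<open>\<open>c i j\<close> is the central product \<open>h i j * h j i\<close>. By
  \<open>h_inv_c\<close> the weights in the theorem turn inverses into factors with reversed
  indices.\<close>

locale dunkl_inv = dunkl_ring +
  fixes h_inv c :: "nat \<Rightarrow> nat \<Rightarrow> 'a"
  assumes c_central: "c i j * y = y * c i j"
    and h_inv: "1 \<le> i \<Longrightarrow> i < j \<Longrightarrow> j \<le> N \<Longrightarrow> h i j * h_inv i j = 1"
      "1 \<le> i \<Longrightarrow> i < j \<Longrightarrow> j \<le> N \<Longrightarrow> h_inv i j * h i j = 1"
    and h_inv_c: "1 \<le> i \<Longrightarrow> i < j \<Longrightarrow> j \<le> N \<Longrightarrow> h_inv i j * c i j = h j i"
begin

definition dn_inv :: "nat \<Rightarrow> nat set \<Rightarrow> 'a"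
  where "dn_inv j S = prod_list (map (\<lambda>i. h_inv i j) (rev (sorted_list_of_set S)))"

lemma dn_inv_empty [simp]: "dn_inv j {} = 1"
  by (simp add: dn_inv_def)

lemma dn_inv_insert: "finite S \<Longrightarrow> \<forall>i\<in>S. i < e \<Longrightarrow> dn_inv j (insert e S) = h_inv e j * dn_inv j S"
  by (simp add: dn_inv_def sorted_list_of_set_insert_max del: sorted_list_of_set_insert_remove)

lemma commute_dn_inv: "finite S \<Longrightarrow> (\<And>i. i \<in> S \<Longrightarrow> y * h_inv i j = h_inv i j * y) \<Longrightarrow> y * dn_inv j S = dn_inv j S * y"
  unfolding dn_inv_def by (auto intro!: commute_prod_list)

lemma commute_h_inv:
  assumes "1 \<le> i" "i < j" "j \<le> N" "y * h i j = h i j * y"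
  shows "y * h_inv i j = h_inv i j * y"
proof -
  have "y * h_inv i j = h_inv i j * (h i j * y) * h_inv i j"
    using h_inv(2)[OF assms(1-3)] by (simp flip: mult.assoc)
  also have "\<dots> = h_inv i j * y * (h i j * h_inv i j)"
    unfolding assms(4)[symmetric] by (simp only: mult.assoc)
  finally show ?thesis using h_inv(1)[OF assms(1-3)] by simp
qed

text \<open>The right half is cut off at \<open>m\<close> and \<open>X\<close> is free, to permit
  induction on \<open>m\<close>; the Dunkl element itself has \<open>X = x\<close> and
  \<open>m = N\<close>.\<close>

definition dunkl_elt :: "(nat \<Rightarrow> 'a) \<Rightarrow> nat \<Rightarrow> nat \<Rightarrow> 'a"
  where "dunkl_elt X m i = dn_inv i {1..<i} * X i * dn i {i<..m}"

primrec left_inv :: "nat \<Rightarrow> nat set \<Rightarrow> 'a" where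
  "left_inv 0 I = 1"
| "left_inv (Suc m) I = left_inv m I * (if Suc m \<in> I then dn_inv (Suc m) ({1..m} - I) else 1)"

lemma left_inv_cong: "{1..m} \<inter> I = {1..m} \<inter> I' \<Longrightarrow> left_inv m I = left_inv m I'"
proof (induction m)
  case (Suc m)
  have *: "{1..Suc m} = insert (Suc m) {1..m}" by auto
  have "{1..m} \<inter> I = {1..m} \<inter> I'" "Suc m \<in> I \<longleftrightarrow> Suc m \<in> I'" using Suc(2) unfolding * by auto
  moreover from this have "{1..m} - I = {1..m} - I'" by auto
  ultimately show ?case using Suc(1) by simp
qed simp

text \<open>Describes how the left half of a new Dunkl element passes the rows already on the right:
  inverses of \<open>h i n\<close> with \<open>i\<close> in \<open>J\<close> cancel, the others move
  to the front by the Yang--Baxter equation.\<close>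

lemma up_right_dn_inv:
  assumes "m < n" "n \<le> N"
  shows "up ({1..m} \<inter> J) n * right m J * dn_inv n {1..m} = dn_inv n ({1..m} - J) * right m J"
  using assms
proof (induction m)
  case (Suc m)
  let ?e = "Suc m" and ?J = "{1..m} \<inter> J" and ?C = "{1..m} - J"
  have IH: "up ?J n * right m J * dn_inv n {1..m} = dn_inv n ?C * right m J"
    using Suc by simp
  have e: "1 \<le> ?e" "?e < n" "n \<le> N" using Suc by auto
  have "{1..?e} = insert ?e {1..m}" by auto
  then have dn_inv: "dn_inv n {1..?e} = h_inv ?e n * dn_inv n {1..m}"
    using dn_inv_insert[of "{1..m}" ?e n] by simp
  have "h ?e n * right m J = right m J * h ?e n"
    by (rule commute_right) (use Suc.prems in \<open>auto intro!: h_comm\<close>)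
  then have hr: "right m J * h_inv ?e n = h_inv ?e n * right m J"
    using commute_h_inv[OF e, of "right m J"] by simp
  show ?case
  proof (cases "?e \<in> J")
    case True
    then have sets: "{1..?e} \<inter> J = insert ?e ?J" "{1..?e} - J = ?C" by (auto simp: le_Suc_eq)
    have "up ({1..?e} \<inter> J) n = up ?J n * h ?e n"
      unfolding sets by (rule up_insert) auto
    then have "up ({1..?e} \<inter> J) n * right ?e J * dn_inv n {1..?e}
      = up ?J n * h ?e n * (right m J * h_inv ?e n) * dn_inv n {1..m}"
      unfolding dn_inv using True by (simp add: mult.assoc)
    also have "\<dots> = up ?J n * (h ?e n * h_inv ?e n) * right m J * dn_inv n {1..m}"
      unfolding hr by (simp only: mult.assoc)
    also have "\<dots> = dn_inv n ({1..?e} - J) * right ?e J"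
      unfolding h_inv(1)[OF e] sets using IH True by simp
    finally show ?thesis .
  next
    case False
    then have sets: "{1..?e} \<inter> J = ?J" "{1..?e} - J = insert ?e ?C" by (auto simp: le_Suc_eq)
    have dC: "dn_inv n ({1..?e} - J) = h_inv ?e n * dn_inv n ?C"
      unfolding sets by (rule dn_inv_insert) auto
    have r: "right ?e J = up ?J ?e * right m J" using False by simp
    \<comment> \<open>Multiplied by \<open>h_inv ?e n\<close> on both sides, this becomes the
      version \<open>yb\<close> with the inverse.\<close>
    have "h ?e n * up ?J n * up ?J ?e = up ?J ?e * up ?J n * h ?e n"
      by (rule yb_up_set) (use Suc.prems in auto)
    then have "h_inv ?e n * (h ?e n * up ?J n * up ?J ?e) * h_inv ?e n = h_inv ?e n * (up ?J ?e * up ?J n * h ?e n) * h_inv ?e n"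
      by simp
    then have "(h_inv ?e n * h ?e n) * up ?J n * up ?J ?e * h_inv ?e n = h_inv ?e n * up ?J ?e * up ?J n * (h ?e n * h_inv ?e n)"
      by (simp only: mult.assoc)
    then have yb: "up ?J n * up ?J ?e * h_inv ?e n = h_inv ?e n * up ?J ?e * up ?J n"
      unfolding h_inv[OF e] by simp
    have cu: "up ?J ?e * dn_inv n ?C = dn_inv n ?C * up ?J ?e"
    proof (intro commute_dn_inv commute_h_inv)
      show "up ?J ?e * h i n = h i n * up ?J ?e" if "i \<in> ?C" for i
        by (rule h_commute_up[symmetric]) (use that Suc.prems in auto)
    qed (use Suc.prems in auto)
    have "up ({1..?e} \<inter> J) n * right ?e J * dn_inv n {1..?e}
      = up ?J n * up ?J ?e * (right m J * h_inv ?e n) * dn_inv n {1..m}"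
      unfolding dn_inv r sets by (simp only: mult.assoc)
    also have "\<dots> = (up ?J n * up ?J ?e * h_inv ?e n) * right m J * dn_inv n {1..m}"
      unfolding hr by (simp only: mult.assoc)
    also have "\<dots> = h_inv ?e n * up ?J ?e * (up ?J n * right m J * dn_inv n {1..m})"
      unfolding yb by (simp only: mult.assoc)
    also have "\<dots> = h_inv ?e n * (up ?J ?e * dn_inv n ?C) * right m J"
      unfolding IH by (simp only: mult.assoc)
    also have "\<dots> = dn_inv n ({1..?e} - J) * right ?e J"
      unfolding cu dC r by (simp only: mult.assoc)
    finally show ?thesis .
  qed
qed simp

lemma prod_mult_up:
  assumes "finite I" "\<And>i k. i \<in> I \<Longrightarrow> k \<in> I \<Longrightarrow> i \<noteq> k \<Longrightarrow> X k * h i e = h i e * X k"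
  shows "prod_list (map (\<lambda>i. X i * h i e) (sorted_list_of_set I)) = prod_list (map X (sorted_list_of_set I)) * up I e"
  using assms
proof (induction I rule: finite_linorder_max_induct)
  case (insert p I)
  have c: "X p * up I e = up I e * X p"
    by (rule commute_up) (use insert in auto)
  have "prod_list (map X (sorted_list_of_set I)) * up I e * (X p * h p e)
      = prod_list (map X (sorted_list_of_set I)) * (up I e * X p) * h p e"
    by (simp only: mult.assoc)
  also have "\<dots> = prod_list (map X (sorted_list_of_set I)) * X p * (up I e * h p e)"
    unfolding c[symmetric] by (simp only: mult.assoc)
  finally have "prod_list (map X (sorted_list_of_set I)) * up I e * (X p * h p e)
      = prod_list (map X (sorted_list_of_set I)) * X p * (up I e * h p e)" .
  moreover have "sorted_list_of_set (insert p I) = sorted_list_of_set I @ [p]"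
    using insert.hyps by (intro sorted_list_of_set_insert_max) auto
  moreover have "up (insert p I) e = up I e * h p e"
    using insert.hyps by (intro up_insert) auto
  ultimately show ?case using insert by (simp del: sorted_list_of_set_insert_remove)
qed simp

text \<open>
  The family \<open>X\<close> is arbitrary because the induction passes from \<open>X\<^sub>i\<close> to \<open>X\<^sub>i h\<^sub>i\<^sub>n\<close>, which no longer commute
  with each other.
\<close>

lemma prod_dunkl_elt:
  assumes "m \<le> N" "I \<subseteq> {1..m}"
    "\<And>i j k. {i, j, k} \<subseteq> {1..m} \<Longrightarrow> i \<noteq> j \<Longrightarrow> k \<notin> {i, j} \<Longrightarrow> X k * h i j = h i j * X k"
  shows "prod_list (map (dunkl_elt X m) (sorted_list_of_set I))
    = left_inv m I * prod_list (map X (sorted_list_of_set I)) * right m I"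
  using assms
proof (induction m arbitrary: I X)
  case (Suc m)
  let ?e = "Suc m"
  \<comment> \<open>\<open>X'\<close> absorbs \<open>h i ?e\<close>, the first factor in the right
    half of every Dunkl element below \<open>?e\<close>.\<close>
  define X' where "X' i = X i * h i ?e" for i
  have IH: "prod_list (map (dunkl_elt X' m) (sorted_list_of_set J))
    = left_inv m J * prod_list (map X' (sorted_list_of_set J)) * right m J" if "J \<subseteq> {1..m}" for J
  proof (rule Suc.IH[OF _ that])
    show "X' k * h i j = h i j * X' k" if "{i, j, k} \<subseteq> {1..m}" "i \<noteq> j" "k \<notin> {i, j}" for i j k
    proof -
      have "h i j * X k = X k * h i j" by (rule Suc.prems(3)[symmetric]) (use that in auto)
      moreover have "h i j * h k ?e = h k ?e * h i j" by (rule h_comm) (use that Suc.prems(1) in auto)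
      ultimately show ?thesis unfolding X'_def by (rule commute_mult[symmetric])
    qed
  qed (use Suc.prems in simp)
  have DX: "prod_list (map (dunkl_elt X ?e) (sorted_list_of_set J))
    = left_inv m J * prod_list (map X (sorted_list_of_set J)) * up J ?e * right m J" if J: "J \<subseteq> {1..m}" for J
  proof -
    have fin: "finite J" using J finite_subset by blast
    have "dunkl_elt X ?e i = dunkl_elt X' m i" if "i \<in> J" for i
    proof -
      have "i \<le> m" using that J by auto
      then have "{i<..?e} = insert ?e {i<..m}" by auto
      then have "dn i {i<..?e} = h i ?e * dn i {i<..m}" by (simp add: dn_insert)
      then show ?thesis by (simp add: dunkl_elt_def X'_def mult.assoc)
    qed
    then have "map (dunkl_elt X ?e) (sorted_list_of_set J) = map (dunkl_elt X' m) (sorted_list_of_set J)"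
      using fin by (intro map_cong) auto
    moreover have "prod_list (map X' (sorted_list_of_set J)) = prod_list (map X (sorted_list_of_set J)) * up J ?e"
      unfolding X'_def
    proof (rule prod_mult_up[OF fin])
      show "X k * h i ?e = h i ?e * X k" if "i \<in> J" "k \<in> J" "i \<noteq> k" for i k
        by (rule Suc.prems(3)) (use J that in auto)
    qed
    ultimately show ?thesis using IH[OF J] by (simp only: mult.assoc)
  qed
  show ?case
  proof (cases "?e \<in> I")
    case False
    then have I: "I \<subseteq> {1..m}" using Suc.prems(2) by (auto simp: le_Suc_eq)
    then have "{1..m} \<inter> I = I" by auto
    then show ?thesis using DX[OF I] False by (simp add: mult.assoc)
  next
    case True
    define J where "J = I - {?e}"
    have J: "J \<subseteq> {1..m}" "finite J" "?e \<notin> J" and I: "I = insert ?e J"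
      using Suc.prems(2) True finite_subset[OF Suc.prems(2)] by (auto simp: J_def le_Suc_eq)
    have Jm: "{1..m} \<inter> J = J" "{1..m} - insert ?e J = {1..m} - J" using J by auto
    have sl: "sorted_list_of_set I = sorted_list_of_set J @ [?e]"
      unfolding I by (rule sorted_list_of_set_insert_max) (use J in auto)
    have cong: "left_inv m I = left_inv m J" "right m I = right m J"
      by (rule left_inv_cong right_cong; use I J in auto)+
    let ?P = "prod_list (map X (sorted_list_of_set J))"
    have c1: "?P * dn_inv ?e ({1..m} - J) = dn_inv ?e ({1..m} - J) * ?P"
    proof (rule commute_dn_inv)
      fix i assume i: "i \<in> {1..m} - J"
      have "h i ?e * ?P = ?P * h i ?e"
      proof (rule commute_prod_list)
        fix y assume "y \<in> set (map X (sorted_list_of_set J))"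
        then obtain k where k: "k \<in> J" "y = X k" using J by auto
        show "h i ?e * y = y * h i ?e"
          unfolding k(2) by (rule Suc.prems(3)[symmetric]) (use i k J in auto)
      qed
      then show "?P * h_inv i ?e = h_inv i ?e * ?P"
        using i Suc.prems(1) by (intro commute_h_inv) auto
    qed simp
    have c2: "X ?e * right m J = right m J * X ?e"
    proof (rule commute_right)
      show "X ?e * h i j = h i j * X ?e" if "i \<in> {1..m}" "j \<in> {1..m}" "i \<in> J" "j \<notin> J" for i j
        by (rule Suc.prems(3)) (use that in auto)
    qed
    have "{1..<?e} = {1..m}" by auto
    then have "prod_list (map (dunkl_elt X ?e) (sorted_list_of_set I))
      = left_inv m J * ?P * (up J ?e * right m J * dn_inv ?e {1..m}) * X ?e"
      unfolding sl using DX[OF J(1)] by (simp add: dunkl_elt_def mult.assoc)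
    \<comment> \<open>The last Dunkl element has an empty right half; its left half meets the rows
      collected so far.\<close>
    also have "up J ?e * right m J * dn_inv ?e {1..m} = dn_inv ?e ({1..m} - J) * right m J"
      using up_right_dn_inv[of m ?e J] Suc.prems(1) Jm by simp
    also have "left_inv m J * ?P * (dn_inv ?e ({1..m} - J) * right m J) * X ?e
      = left_inv m J * (?P * dn_inv ?e ({1..m} - J)) * (right m J * X ?e)"
      by (simp only: mult.assoc)
    also have "\<dots> = left_inv m J * dn_inv ?e ({1..m} - J) * (?P * X ?e) * right m J"
      unfolding c1 c2[symmetric] by (simp only: mult.assoc)
    also have "\<dots> = left_inv ?e I * prod_list (map X (sorted_list_of_set I)) * right ?e I"
      unfolding sl using True I Jm cong by (simp add: mult.assoc)
    finally show ?thesis .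
  qed
qed simp

lemma prod_c_central:
  shows "prod_list (map (\<lambda>(i, j). c i j) L) * y = y * prod_list (map (\<lambda>(i, j). c i j) L)"
    and "a \<in> set (map (\<lambda>(i, j). c i j) L) \<Longrightarrow> a * y = y * a"
proof -
  show *: "a * y = y * a" if a: "a \<in> set (map (\<lambda>(i, j). c i j) L)" for a
  proof -
    obtain i j where "a = c i j" using a by auto
    then show ?thesis using c_central[of i j y] by simp
  qed
  show "prod_list (map (\<lambda>(i, j). c i j) L) * y = y * prod_list (map (\<lambda>(i, j). c i j) L)"
    by (rule commute_prod_list[symmetric]) (rule *[symmetric])
qed

text \<open>Each \<open>h_inv i j\<close> absorbs its own \<open>c i j\<close>. As the latter are
  central, any listing \<open>L\<close> of the pairs without repetition will do.\<close>

lemma left_inv_c: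
  assumes "n \<le> N" "distinct L" "set L = {(i, j). 1 \<le> i \<and> i < j \<and> j \<le> n \<and> i \<notin> I \<and> j \<in> I}"
  shows "left_inv n I * prod_list (map (\<lambda>(i, j). c i j) L) = left n I"
  using assms
proof (induction n arbitrary: L)
  case 0
  then have "set L = {}" by auto
  then show ?case by simp
next
  case (Suc n)
  let ?e = "Suc n" and ?c = "\<lambda>(i, j). c i j"
  have reorder: "prod_list (map ?c L) = prod_list (map ?c L')" if "distinct L" "distinct L'" "set L = set L'" for L L'
  proof (rule prod_list_mset_eq)
    have "mset L = mset L'" using that set_eq_iff_mset_eq_distinct by blast
    then show "mset (map ?c L) = mset (map ?c L')" by simp
    show "a * b = b * a" if "a \<in> set (map ?c L)" for a b
      using that prod_c_central(2) by blast
  qed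
  define L1 where "L1 = filter (\<lambda>(i, j). j \<noteq> ?e) L"
  have L1: "distinct L1" "set L1 = {(i, j). 1 \<le> i \<and> i < j \<and> j \<le> n \<and> i \<notin> I \<and> j \<in> I}"
  proof -
    show "distinct L1" using Suc.prems(2) by (simp add: L1_def)
    show "set L1 = {(i, j). 1 \<le> i \<and> i < j \<and> j \<le> n \<and> i \<notin> I \<and> j \<in> I}"
      unfolding L1_def set_filter Suc.prems(3) by (auto simp: le_Suc_eq)
  qed
  have IH: "left_inv n I * prod_list (map ?c L1) = left n I"
    using Suc.IH[OF _ L1] Suc.prems(1) by simp
  show ?case
  proof (cases "?e \<in> I")
    case False
    have "\<forall>p\<in>set L. case p of (i, j) \<Rightarrow> j \<noteq> ?e"
      using False unfolding Suc.prems(3) by auto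
    then have "L1 = L" unfolding L1_def by (simp only: filter_id_conv)
    then show ?thesis using IH False by (simp only: left_inv.simps left.simps if_False mult_1_right)
  next
    case True
    let ?C = "{1..n} - I"
    \<comment> \<open>The pairs with second entry \<open>?e\<close>, in the order of
      \<open>dn_inv\<close>, so that \<open>d\<close> can match the factors one by one.\<close>
    define L2 where "L2 = map (\<lambda>i. (i, ?e)) (rev (sorted_list_of_set ?C))"
    have "set L1 \<inter> set L2 = {}" unfolding L1(2) by (auto simp: L2_def)
    then have "distinct (L1 @ L2)"
      using L1(1) by (simp add: L2_def distinct_map inj_on_def)
    moreover have "set L = set (L1 @ L2)"
      unfolding Suc.prems(3) set_append L1(2) using True by (auto simp: L2_def le_Suc_eq)
    ultimately have L: "prod_list (map ?c L) = prod_list (map ?c L1) * prod_list (map ?c L2)"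
      using reorder[OF Suc.prems(2), of "L1 @ L2"] by simp
    have d: "dn_inv ?e S * prod_list (map ?c (map (\<lambda>i. (i, ?e)) (rev (sorted_list_of_set S)))) = dn ?e S"
      if "finite S" "S \<subseteq> {1..n}" for S
      using that
    proof (induction S rule: finite_linorder_max_induct)
      case (insert p S)
      have sl: "sorted_list_of_set (insert p S) = sorted_list_of_set S @ [p]"
        using insert.hyps by (intro sorted_list_of_set_insert_max) auto
      let ?Q = "prod_list (map ?c (map (\<lambda>i. (i, ?e)) (rev (sorted_list_of_set S))))"
      have "dn_inv ?e (insert p S) * prod_list (map ?c (map (\<lambda>i. (i, ?e)) (rev (sorted_list_of_set (insert p S)))))
        = h_inv p ?e * (dn_inv ?e S * c p ?e) * ?Q"
        unfolding sl using insert.hyps by (simp add: dn_inv_insert mult.assoc)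
      also have "\<dots> = (h_inv p ?e * c p ?e) * (dn_inv ?e S * ?Q)"
        unfolding c_central[of p ?e "dn_inv ?e S", symmetric] by (simp only: mult.assoc)
      also have "\<dots> = h ?e p * dn ?e S"
        using insert Suc.prems(1) h_inv_c[of p ?e] by simp
      also have "\<dots> = dn ?e (insert p S)"
        using insert.hyps by (intro dn_insert[symmetric]) auto
      finally show ?case .
    qed simp
    have "left_inv ?e I * prod_list (map ?c L)
      = left_inv n I * (dn_inv ?e ?C * prod_list (map ?c L1)) * prod_list (map ?c L2)"
      unfolding L using True by (simp add: mult.assoc)
    also have "\<dots> = (left_inv n I * prod_list (map ?c L1)) * (dn_inv ?e ?C * prod_list (map ?c L2))"
      unfolding prod_c_central(1)[of L1 "dn_inv ?e ?C", symmetric] by (simp only: mult.assoc)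
    also have "\<dots> = left ?e I"
      unfolding IH using d[of ?C] True by (simp add: L2_def)
    finally show ?thesis .
  qed
qed

lemma prod_dunkl_elt_c:
  assumes "I \<subseteq> {1..N}" "distinct L" "set L = {(i, j). 1 \<le> i \<and> i < j \<and> j \<le> N \<and> i \<notin> I \<and> j \<in> I}"
  shows "prod_list (map (dunkl_elt x N) (sorted_list_of_set I)) * prod_list (map (\<lambda>(i, j). c i j) L)
    = left N I * x_prod I * right N I"
proof -
  let ?P = "prod_list (map (\<lambda>(i, j). c i j) L)"
  have "prod_list (map (dunkl_elt x N) (sorted_list_of_set I)) * ?P = left_inv N I * (x_prod I * right N I * ?P)"
    using assms prod_dunkl_elt[of N I x] x_h by (simp add: x_prod_def mult.assoc)
  also have "\<dots> = (left_inv N I * ?P) * x_prod I * right N I"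
    unfolding prod_c_central(1)[of L "x_prod I * right N I", symmetric] by (simp only: mult.assoc)
  finally show ?thesis unfolding left_inv_c[OF order_refl assms(2,3)] .
qed

theorem sum_dunkl_elt:
  assumes "\<And>I. I \<subseteq> {1..N} \<Longrightarrow> distinct (L I)"
    "\<And>I. I \<subseteq> {1..N} \<Longrightarrow> set (L I) = {(i, j). 1 \<le> i \<and> i < j \<and> j \<le> N \<and> i \<notin> I \<and> j \<in> I}"
  shows "(\<Sum>I\<in>ksubsets N k. prod_list (map (dunkl_elt x N) (sorted_list_of_set I)) * prod_list (map (\<lambda>(i, j). c i j) (L I)))
    = (\<Sum>l\<in>increasing_lists N k. list_term N k l)"
proof -
  have "(\<Sum>I\<in>ksubsets N k. prod_list (map (dunkl_elt x N) (sorted_list_of_set I)) * prod_list (map (\<lambda>(i, j). c i j) (L I)))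
    = dunkl_sum N k"
    unfolding dunkl_sum_def by (rule sum.cong[OF refl]) (use assms prod_dunkl_elt_c in auto)
  then show ?thesis by (simp only: dunkl_sum_eq[OF order_refl])
qed

end

section \<open>The presentation\<close>

text \<open>Meant for \<open>A = h i j\<close>, \<open>B = h i k\<close>, \<open>C = h j k\<close>
  and \<open>p = 1 + s\<close>, where \<open>p - A\<close> and its analogues have reversed indices.
  Both products in the first claim reduce to \<open>C * A * C + c * B - s * C\<close>.\<close>

lemma yang_baxter_of_quadratic:
  fixes A B C p s c :: "'a::ring_1"
  assumes p: "\<And>y. p * y = y * p" and c: "\<And>y. c * y = y * c" and s: "\<And>y. s * y = y * s"
    and CC: "C * C = p * C - c"
    and BA: "B * A = p * B - C * B + A * C - s"
    and AB: "A * B = p * B - B * C + C * A - s"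
  shows "A * B * C = C * B * A" and "(p - C) * (p - B) * (p - A) = (p - A) * (p - B) * (p - C)"
proof -
  have "A * B * C = p * (B * C) - B * (C * C) + C * A * C - s * C"
    unfolding AB by (simp add: algebra_simps)
  also have "\<dots> = C * A * C + c * B - s * C"
    unfolding CC using p[of B] c[of B] by (simp add: algebra_simps) (simp flip: mult.assoc)
  also have "\<dots> = p * (C * B) - (C * C) * B + C * A * C - s * C"
    unfolding CC by (simp add: algebra_simps)
  also have "\<dots> = C * (p * B) - (C * C) * B + C * A * C - C * s"
    using p[of C] s[of C] by (simp flip: mult.assoc)
  also have "\<dots> = C * (B * A)"
    unfolding BA by (simp add: algebra_simps)
  finally show 1: "A * B * C = C * B * A" by (simp add: mult.assoc)
  \<comment> \<open>The sum of pairwise products is invariant under reversal; with the first claim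
    this settles the expansion \<open>pp\<close>.\<close>
  have 2: "A * B + B * C + A * C = B * A + C * B + C * A"
    unfolding AB BA by (simp add: algebra_simps)
  have pp: "(p - a) * (p - b) * (p - d) = p * p * p - p * p * (a + b + d) + p * (a * b + b * d + a * d) - a * b * d"
    for a b d
  proof -
    have "a * p = p * a" "b * p = p * b" "d * p = p * d" using p by simp_all
    moreover have "a * (b * p) = p * (a * b)" using p[of "a * b"] by (simp add: mult.assoc)
    moreover have "a * (p * y) = p * (a * y)" "b * (p * y) = p * (b * y)" for y
      using p[of a] p[of b] by (simp_all flip: mult.assoc)
    ultimately show ?thesis by (simp add: algebra_simps)
  qed
  have "C * B + B * A + C * A = A * B + B * C + A * C"
    using 2 by (simp add: algebra_simps)
  then show "(p - C) * (p - B) * (p - A) = (p - A) * (p - B) * (p - C)"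
    unfolding pp using 1 by (simp add: algebra_simps)
qed

lemma power_one_plus_binomial:
  fixes w :: "'a::ring_1"
  shows "(1 + w) ^ m = (\<Sum>j\<le>m. of_nat (m choose j) * w ^ j)"
proof (induction m)
  case (Suc m)
  have "(\<Sum>j\<le>Suc m. of_nat (Suc m choose j) * w ^ j)
      = 1 + (\<Sum>j\<le>m. of_nat (m choose Suc j) * w ^ Suc j) + (\<Sum>j\<le>m. of_nat (m choose j) * w ^ Suc j)"
    by (subst sum.atMost_Suc_shift)
      (simp add: distrib_right sum.distrib algebra_simps del: sum.atMost_Suc power_Suc)
  also have "1 + (\<Sum>j\<le>m. of_nat (m choose Suc j) * w ^ Suc j) = (\<Sum>j\<le>Suc m. of_nat (m choose j) * w ^ j)"
    by (subst sum.atMost_Suc_shift) (simp del: power_Suc)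
  also have "\<dots> = (1 + w) ^ m"
    using Suc by (simp add: binomial_eq_0)
  also have "(\<Sum>j\<le>m. of_nat (m choose j) * w ^ Suc j) = (1 + w) ^ m * w"
    unfolding Suc sum_distrib_right by (simp only: power_Suc2 mult.assoc)
  finally show ?case by (simp only: power_Suc2 distrib_left mult_1_right)
qed simp

text \<open>For \<open>s = 1 + t * b\<close> one has \<open>s ^ m - 1 = t * b * qint s m\<close>, so
  the formal quotient by \<open>b\<close> is \<open>t * qint s m\<close>. Since \<open>b\<close>
  cannot be cancelled in general, the proof is by induction with Pascal's rule.\<close>

lemma binomial_quotient:
  fixes t b :: "'a::ring_1"
  assumes "\<And>y. t * y = y * t"
  shows "(\<Sum>r\<in>{1..m}. of_nat (m choose r) * (t ^ r * b ^ (r - 1))) = t * qint (1 + t * b) m"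
proof (induction m)
  case (Suc m)
  have tp: "t ^ j * b ^ j = (t * b) ^ j" for j
  proof (induction j)
    case (Suc j)
    have "t * t ^ j * (b * b ^ j) = t * (t ^ j * b) * b ^ j" by (simp add: mult.assoc)
    also have "t ^ j * b = b * t ^ j" by (rule power_commuting_commutes) (rule assms)
    finally show ?case using Suc by (simp add: mult.assoc)
  qed simp
  have "(\<Sum>r\<in>{1..Suc m}. of_nat (Suc m choose r) * (t ^ r * b ^ (r - 1)))
      = (\<Sum>j\<le>m. of_nat (Suc m choose Suc j) * (t ^ Suc j * b ^ j))"
    by (rule sum.reindex_bij_witness[of _ Suc "\<lambda>r. r - 1"]) (auto simp del: binomial_Suc_Suc power_Suc)
  also have "\<dots> = (\<Sum>j\<le>m. of_nat (m choose Suc j) * (t ^ Suc j * b ^ j)) + (\<Sum>j\<le>m. t * (of_nat (m choose j) * (t * b) ^ j))"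
  proof -
    have "of_nat (m choose j) * (t ^ Suc j * b ^ j) = t * (of_nat (m choose j) * (t * b) ^ j)" for j
      using assms[of "of_nat (m choose j)"] by (simp add: mult.assoc flip: tp) (simp flip: mult.assoc)
    then show ?thesis by (simp add: distrib_right sum.distrib add.commute del: power_Suc)
  qed
  also have "(\<Sum>j\<le>m. of_nat (m choose Suc j) * (t ^ Suc j * b ^ j)) = (\<Sum>r\<in>{1..Suc m}. of_nat (m choose r) * (t ^ r * b ^ (r - 1)))"
    by (rule sum.reindex_bij_witness[of _ "\<lambda>r. r - 1" Suc]) (auto simp del: power_Suc)
  also have "\<dots> = (\<Sum>r\<in>{1..m}. of_nat (m choose r) * (t ^ r * b ^ (r - 1)))"
    by (simp add: binomial_eq_0)
  also have "(\<Sum>j\<le>m. t * (of_nat (m choose j) * (t * b) ^ j)) = t * (1 + t * b) ^ m"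
    by (simp only: power_one_plus_binomial sum_distrib_left)
  finally show ?case using Suc by (simp add: distrib_left)
qed simp

section \<open>The relations of the algebra in a type-class ring\<close>

text \<open>Centrality is demanded at all indices, so an interpretation must choose central values
  outside the range as well.\<close>

locale ht_presentation =
  fixes n :: nat and b t :: "'a::ring_1" and H z :: "nat \<Rightarrow> 'a" and q E u :: "nat \<Rightarrow> nat \<Rightarrow> 'a"
  assumes b_central: "b * y = y * b" and t_central: "t * y = y * t"
    and H_central: "H i * y = y * H i" and q_central: "q i j * y = y * q i j"
    and E_central: "E i j * y = y * E i j"
    and E_inverse: "1 \<le> i \<Longrightarrow> i < j \<Longrightarrow> j \<le> n \<Longrightarrow> (1 + t * b - t ^ 2 * q i j) * E i j = 1"
    and z_z: "i \<in> {1..n} \<Longrightarrow> j \<in> {1..n} \<Longrightarrow> z i * z j = z j * z i"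
    and u_u: "1 \<le> i \<Longrightarrow> i < j \<Longrightarrow> j \<le> n \<Longrightarrow> 1 \<le> k \<Longrightarrow> k < l \<Longrightarrow> l \<le> n \<Longrightarrow> {i, j} \<inter> {k, l} = {} \<Longrightarrow>
      u i j * u k l = u k l * u i j"
    and three1: "1 \<le> i \<Longrightarrow> i < j \<Longrightarrow> j < k \<Longrightarrow> k \<le> n \<Longrightarrow>
      u i j * u j k = u i k * u i j + u j k * u i k - b * u i k"
    and three2: "1 \<le> i \<Longrightarrow> i < j \<Longrightarrow> j < k \<Longrightarrow> k \<le> n \<Longrightarrow>
      u j k * u i j = u i j * u i k + u i k * u j k - b * u i k"
    and quad: "1 \<le> i \<Longrightarrow> i < j \<Longrightarrow> j \<le> n \<Longrightarrow> (u i j)^2 - b * u i j = q i j"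
    and z_u: "i \<in> {1..n} \<Longrightarrow> 1 \<le> k \<Longrightarrow> k < l \<Longrightarrow> l \<le> n \<Longrightarrow> i \<notin> {k, l} \<Longrightarrow> z i * u k l = u k l * z i"
    and z_u_left: "1 \<le> i \<Longrightarrow> i < j \<Longrightarrow> j \<le> n \<Longrightarrow> z i * u i j = u i j * z j + b * z i + H j"
    and z_u_right: "1 \<le> i \<Longrightarrow> i < j \<Longrightarrow> j \<le> n \<Longrightarrow> z j * u i j = u i j * z i - b * z i - H j"
begin

definition "s = 1 + t * b"
text \<open>For \<open>j < i\<close> this is the numerator of the inverse of
  \<open>h j i\<close>.\<close>

definition "h i j = (if i < j then 1 + t * u i j else 1 + t * (b - u j i))"
definition "x i = 1 + z i"
definition "\<gamma> j = t * (H j - b)"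
definition "c i j = 1 + t * b - t ^ 2 * q i j"
definition "h_inv i j = E i j * h j i"

lemma s_commute: "s * y = y * s"
  using t_central[of b] t_central[of y] b_central[of y] unfolding s_def
  by (simp add: algebra_simps) (simp flip: mult.assoc)

lemma c_commute: "c i j * y = y * c i j"
proof -
  have "t ^ 2 * q i j * y = y * (t ^ 2 * q i j)"
    by (rule commute_mult[symmetric]) (simp_all add: q_central power_commuting_commutes[OF t_central])
  then show ?thesis using s_commute[of y] unfolding c_def s_def by (simp add: algebra_simps)
qed

lemma h_add: "i < j \<Longrightarrow> h i j + h j i = 1 + s"
  by (simp add: h_def s_def algebra_simps)

lemma collect_t: "t * (y * (t * w)) = t ^ 2 * (y * w)" "t * (y * t) = t ^ 2 * y" "t * (t * y) = t ^ 2 * y"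
proof -
  show "t * (t * y) = t ^ 2 * y" for y by (simp add: power2_eq_square mult.assoc)
  then show "t * (y * t) = t ^ 2 * y" by (simp flip: t_central)
  have "t * (y * (t * w)) = t * (y * t * w)" by (simp add: mult.assoc)
  also have "\<dots> = t ^ 2 * (y * w)"
    unfolding t_central[of y, symmetric] by (simp add: power2_eq_square mult.assoc)
  finally show "t * (y * (t * w)) = t ^ 2 * (y * w)" .
qed

lemma h_mult_u:
  "(1 + t * a) * (1 + t * a') = 1 + t * (a + a') + t ^ 2 * (a * a')"
proof -
  have "t * a * (t * a') = t ^ 2 * (a * a')" by (simp add: mult.assoc collect_t)
  then show ?thesis by (simp add: algebra_simps)
qed

text \<open>The quadratic relation says \<open>u i j * (b - u i j) = - q i j\<close>.\<close>

lemma h_inverse: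
  assumes "1 \<le> i" "i < j" "j \<le> n"
  shows "h i j * h j i = c i j" "h j i * h i j = c i j"
proof -
  have uu: "u i j * u i j = b * u i j + q i j"
    using quad[OF assms] by (simp add: power2_eq_square algebra_simps)
  show "h i j * h j i = c i j" "h j i * h i j = c i j"
    using assms(2) b_central[of "u i j"] uu
    by (simp_all add: h_def h_mult_u c_def collect_t algebra_simps)
qed

lemma h_quadratic:
  assumes "1 \<le> i" "i < j" "j \<le> n"
  shows "h i j * h i j = (1 + s) * h i j - c i j"
proof -
  have "h j i = 1 + s - h i j" using h_add[OF assms(2)] by (simp add: algebra_simps)
  then have "h i j * (1 + s - h i j) = c i j" using h_inverse(1)[OF assms] by simp
  then show ?thesis using s_commute[of "h i j"] by (simp add: algebra_simps)
qed

text \<open>Expansion in powers of \<open>t\<close>, where \<open>three1\<close> and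
  \<open>three2\<close> settle the coefficient of \<open>t ^ 2\<close>. Reversed factors are
  eliminated, as \<open>yang_baxter_of_quadratic\<close> requires.\<close>

lemma h_three:
  assumes "1 \<le> i" "i < j" "j < k" "k \<le> n"
  shows "h i k * h i j = (1 + s) * h i k - h j k * h i k + h i j * h j k - s"
    and "h i j * h i k = (1 + s) * h i k - h i k * h j k + h j k * h i j - s"
proof -
  have e: "(1 + s) * h i k = 1 + s + t * u i k + t * u i k + t ^ 2 * (b * u i k)"
  proof -
    have "t * b * (t * u i k) = t ^ 2 * (b * u i k)" by (simp add: mult.assoc collect_t)
    then show ?thesis using assms by (simp add: s_def h_def algebra_simps)
  qed
  have 1: "u i k * u i j = u i j * u j k - u j k * u i k + b * u i k"
    using three1[OF assms] by (simp add: algebra_simps)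
  have 2: "u i j * u i k = u j k * u i j - u i k * u j k + b * u i k"
    using three2[OF assms] by (simp add: algebra_simps)
  show "h i k * h i j = (1 + s) * h i k - h j k * h i k + h i j * h j k - s"
    unfolding e using assms by (simp add: h_def h_mult_u 1 collect_t algebra_simps)
  show "h i j * h i k = (1 + s) * h i k - h i k * h j k + h j k * h i j - s"
    unfolding e using assms by (simp add: h_def h_mult_u 2 collect_t algebra_simps)
qed

lemma commute_h:
  assumes "i \<noteq> j" "y * u (min i j) (max i j) = u (min i j) (max i j) * y"
  shows "y * h i j = h i j * y"
proof (cases "i < j")
  case True
  then have "y * u i j = u i j * y" using assms by simp
  then have "y * (t * u i j) = t * u i j * y" by (intro commute_mult) (simp_all add: t_central[of y])
  then show ?thesis using True by (simp add: h_def algebra_simps)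
next
  case False
  then have "y * u j i = u j i * y" using assms by simp
  then have "y * (b - u j i) = (b - u j i) * y" using b_central[of y] by (simp add: algebra_simps)
  then have "y * (t * (b - u j i)) = t * (b - u j i) * y" by (intro commute_mult) (simp_all add: t_central[of y])
  then show ?thesis using False by (simp add: h_def distrib_left distrib_right)
qed

text \<open>Adding the two relations shows that \<open>z i + z j\<close> commutes with
  \<open>u i j\<close>; applying them in turn shows the same for \<open>z i * z j\<close>, the terms
  with \<open>b\<close> and \<open>H j\<close> cancelling.\<close>

lemma xx_u:
  assumes "1 \<le> i" "i < j" "j \<le> n"
  shows "x i * x j * u i j = u i j * (x i * x j)"
proof -
  have zz: "z i * z j = z j * z i" using assms by (intro z_z) auto
  have "z i * (z j * u i j) = (z i * u i j) * z i - z i * (b * z i) - z i * H j"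
    unfolding z_u_right[OF assms] by (simp add: algebra_simps)
  also have "\<dots> = u i j * (z j * z i)"
    unfolding z_u_left[OF assms] using b_central[of "z i"] H_central[of j "z i"]
    by (simp add: algebra_simps)
  finally have zzu: "z i * (z j * u i j) = u i j * (z i * z j)" using zz by simp
  have "x i * x j * u i j = u i j + z i * u i j + z j * u i j + z i * (z j * u i j)"
    by (simp add: x_def algebra_simps)
  also have "\<dots> = u i j * (x i * x j)"
    unfolding zzu unfolding z_u_left[OF assms] z_u_right[OF assms] by (simp add: x_def algebra_simps)
  finally show ?thesis .
qed

sublocale dunkl_inv n s h x \<gamma> h_inv c
proof
  show "s * y = y * s" for y by (rule s_commute)
  show "h i j + h j i = 1 + s" if "1 \<le> i" "i < j" "j \<le> n" for i j
    using that(2) by (rule h_add)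
  show "h i j * h k l = h k l * h i j"
    if "{i, j, k, l} \<subseteq> {1..n}" "i \<noteq> j" "k \<noteq> l" "{i, j} \<inter> {k, l} = {}" for i j k l
  proof (rule commute_h[OF that(3)], rule commute_h[symmetric, OF that(2)])
    show "u (min k l) (max k l) * u (min i j) (max i j) = u (min i j) (max i j) * u (min k l) (max k l)"
      by (rule u_u) (use that in \<open>auto simp: min_def max_def\<close>)
  qed
  fix i j k :: nat assume ijk: "1 \<le> i" "i < j" "j < k" "k \<le> n"
  have jk: "1 \<le> j" "j < k" "k \<le> n" using ijk by auto
  have rev: "h j i = 1 + s - h i j" "h k i = 1 + s - h i k" "h k j = 1 + s - h j k"
    using h_add[of i j] h_add[of i k] h_add[of j k] ijk by (auto simp: algebra_simps)
  have sc: "h j k * s = s * h j k" "h i j * s = s * h i j" "h i k * s = s * h i k"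
    by (simp_all add: s_commute)
  have pc: "(1 + s) * y = y * (1 + s)" for y using s_commute[of y] by (simp add: algebra_simps)
  show "h i k * h i j = h k j * h i k + h i j * h j k - s"
    unfolding rev h_three(1)[OF ijk] by (simp add: algebra_simps)
  show "h j i * h k i = h k j * h j i + h k i * h j k - s"
    unfolding rev using h_three(2)[OF ijk] by (simp add: algebra_simps sc)
  note yb = yang_baxter_of_quadratic[OF pc c_commute s_commute h_quadratic[OF jk] h_three[OF ijk]]
  show "h i j * h i k * h j k = h j k * h i k * h i j"
    by (rule yb(1))
  show "h k j * h k i * h j i = h j i * h k i * h k j"
    unfolding rev by (rule yb(2))
next
  show "\<gamma> j * y = y * \<gamma> j" for j y
    unfolding \<gamma>_def using t_central[of y] H_central[of j y] b_central[of y]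
    by (intro commute_mult[symmetric]) (simp_all add: algebra_simps)
  show "x i * x j = x j * x i" if "{i, j} \<subseteq> {1..n}" for i j
    using z_z[of i j] that by (simp add: x_def algebra_simps)
  show "x k * h i j = h i j * x k" if "{i, j, k} \<subseteq> {1..n}" "i \<noteq> j" "k \<notin> {i, j}" for i j k
  proof (rule commute_h[OF that(2)])
    have "z k * u (min i j) (max i j) = u (min i j) (max i j) * z k"
      by (rule z_u) (use that in \<open>auto simp: min_def max_def\<close>)
    then show "x k * u (min i j) (max i j) = u (min i j) (max i j) * x k"
      by (simp add: x_def algebra_simps)
  qed
  show "x i * x j * h i j = h i j * (x i * x j)" if "{i, j} \<subseteq> {1..n}" "i \<noteq> j" for i j
  proof (rule commute_h[OF that(2)])
    have "x i * x j = x (min i j) * x (max i j)"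
      using z_z[of i j] that by (auto simp: x_def min_def max_def algebra_simps)
    then show "x i * x j * u (min i j) (max i j) = u (min i j) (max i j) * (x i * x j)"
      using xx_u[of "min i j" "max i j"] that by (auto simp: min_def max_def)
  qed
  show "x i * h i j = s * x i + (h i j - 1) * x j + \<gamma> j" if "1 \<le> i" "i < j" "j \<le> n" for i j
  proof -
    have "x i * h i j = x i + t * u i j + t * (z i * u i j)"
      using that t_central[of "z i"] by (simp add: x_def h_def algebra_simps) (simp flip: mult.assoc)
    also have "\<dots> = s * x i + (h i j - 1) * x j + \<gamma> j"
      unfolding z_u_left[OF that] using that by (simp add: s_def x_def h_def \<gamma>_def algebra_simps)
    finally show ?thesis .
  qed
  show "c i j * y = y * c i j" for i j y by (rule c_commute)
  show "h i j * h_inv i j = 1" "h_inv i j * h i j = 1" "h_inv i j * c i j = h j i"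
    if "1 \<le> i" "i < j" "j \<le> n" for i j
  proof -
    have cE: "c i j * E i j = 1" using E_inverse[OF that] by (simp add: c_def)
    show "h_inv i j * h i j = 1"
      unfolding h_inv_def mult.assoc h_inverse(2)[OF that] using cE E_central[of i j "c i j"] by simp
    show "h i j * h_inv i j = 1"
      unfolding h_inv_def E_central[of i j] mult.assoc[symmetric] h_inverse(1)[OF that] by (rule cE)
    show "h_inv i j * c i j = h j i"
      unfolding h_inv_def E_central[of i j] mult.assoc using cE E_central[of i j "c i j"] by simp
  qed
qed

text \<open>The part of \<open>\<gamma> i\<close> with \<open>b\<close> turns the summand
  \<open>s ^ m\<close> of \<open>x i * s ^ m\<close> into 1, since
  \<open>t * b * qint s m = s ^ m - 1\<close>.\<close>

lemma factor_eq: "factor i m = z i * s ^ m + 1 + H i * (\<Sum>r\<in>{1..m}. of_nat (m choose r) * (t ^ r * b ^ (r - 1)))"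
proof -
  have "1 + s * qint s m = qint s m + s ^ m" using qint_Suc'[of s m] by simp
  then have "t * b * qint s m = s ^ m - 1" by (simp add: s_def algebra_simps)
  then show ?thesis
    unfolding binomial_quotient[OF t_central] factor_def \<gamma>_def x_def using t_central[of "H i"]
    by (simp add: algebra_simps flip: s_def)
qed

end

section \<open>Transfer to the quotient ring\<close>

declare One_nat_def [simp]

section \<open>The quotient map and central coefficients\<close>

lemma ht_class_simps:
  assumes "p \<in> carrier (free_ring (ht_gens n))" "p' \<in> carrier (free_ring (ht_gens n))"
  shows "ht_class n (p * p') = ht_class n p \<otimes>\<^bsub>HT n\<^esub> ht_class n p'"
    and "ht_class n (p + p') = ht_class n p \<oplus>\<^bsub>HT n\<^esub> ht_class n p'"
    and "ht_class n (p - p') = ht_class n p \<ominus>\<^bsub>HT n\<^esub> ht_class n p'"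
proof -
  interpret HT: ring "HT n" by (rule HT_ring)
  note hom = ht_class_ring_hom[of n]
  show "ht_class n (p * p') = ht_class n p \<otimes>\<^bsub>HT n\<^esub> ht_class n p'"
    using ring_hom_mult[OF hom assms] by simp
  show add: "ht_class n (p + p') = ht_class n p \<oplus>\<^bsub>HT n\<^esub> ht_class n p'"
    using ring_hom_add[OF hom assms] by simp
  have d: "p - p' \<in> carrier (free_ring (ht_gens n))" using assms by (rule free_ring_closed)
  have "ht_class n (p - p') \<oplus>\<^bsub>HT n\<^esub> ht_class n p' = ht_class n p"
    using ring_hom_add[OF hom d assms(2)] by simp
  then show "ht_class n (p - p') = ht_class n p \<ominus>\<^bsub>HT n\<^esub> ht_class n p'"
    using ht_class_closed[OF d] ht_class_closed[OF assms(2)]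
    by (metis HT.add.inv_solve_right HT.minus_eq ht_class_closed[OF assms(1)])
qed

lemma ht_class_one: "ht_class n 1 = \<one>\<^bsub>HT n\<^esub>"
  using ring_hom_one[OF ht_class_ring_hom[of n]] by simp

lemma ht_class_zero: "ht_class n 0 = \<zero>\<^bsub>HT n\<^esub>"
proof -
  interpret HT: ring "HT n" by (rule HT_ring)
  have z: "(0 :: gen ncpoly) \<in> carrier (free_ring (ht_gens n))" by (rule free_ring_closed)
  have "ht_class n 0 \<oplus>\<^bsub>HT n\<^esub> ht_class n 0 = ht_class n 0"
    using ht_class_simps(2)[OF z z] by simp
  then show ?thesis using ht_class_closed[OF z] HT.add.l_cancel_one by metis
qed

lemma HT_surj:
  assumes "y \<in> carrier (HT n)"
  obtains p where "p \<in> carrier (free_ring (ht_gens n))" "y = ht_class n p"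
  using assms unfolding HT_def FactRing_def ht_class_def A_RCOSETS_def' by auto

lemma free_ring_word_induct [consumes 1, case_names single add]:
  assumes "p \<in> carrier (free_ring G)"
    and single: "\<And>w k. set w \<subseteq> G \<Longrightarrow> P (Poly_Mapping.single (Word w) k)"
    and add: "\<And>p p'. p \<in> carrier (free_ring G) \<Longrightarrow> p' \<in> carrier (free_ring G) \<Longrightarrow> P p \<Longrightarrow> P p' \<Longrightarrow> P (p + p')"
  shows "P p"
  using assms(1)
proof (induction p rule: update_induct)
  case const
  show ?case using single[of "[]" 0] by simp
next
  case (update p a k)
  have eq: "Poly_Mapping.update a k p = Poly_Mapping.single a k + p"
    using update.hyps(1)
    by (intro poly_mapping_eqI) (auto simp: lookup_update lookup_add lookup_single in_keys_iff when_def)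
  have "set (letters a) \<subseteq> G"
    using update.prems update.hyps unfolding free_ring_carrier by (auto simp: keys_update)
  moreover have "p \<in> carrier (free_ring G)"
    using update.prems update.hyps unfolding free_ring_carrier by (auto simp: keys_update)
  moreover have "P (Poly_Mapping.single a k)" using single[of "letters a" k] calculation(1) by simp
  moreover have "Poly_Mapping.single a k \<in> carrier (free_ring G)"
    using calculation(1) by (auto simp: free_ring_carrier)
  ultimately show ?case unfolding eq using update.IH by (intro add) auto
qed

text \<open>The relation \<open>central\<close> covers generators; induction on words and additivity
  extend it to every class.\<close>

lemma coeff_central:
  assumes "g \<in> coeff_gens n" "y \<in> carrier (HT n)"
  shows "ht_class n (gvar g) \<otimes>\<^bsub>HT n\<^esub> y = y \<otimes>\<^bsub>HT n\<^esub> ht_class n (gvar g)"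
proof -
  interpret HT: ring "HT n" by (rule HT_ring)
  have g: "gvar g \<in> carrier (free_ring (ht_gens n))"
    using assms(1) by (intro free_ring_closed ht_gens_mem)
  obtain p where p: "p \<in> carrier (free_ring (ht_gens n))" "y = ht_class n p"
    using HT_surj[OF assms(2)] .
  have word: "ht_class n (gvar g) \<otimes>\<^bsub>HT n\<^esub> ht_class n (Poly_Mapping.single (Word w) k)
      = ht_class n (Poly_Mapping.single (Word w) k) \<otimes>\<^bsub>HT n\<^esub> ht_class n (gvar g)"
    if "set w \<subseteq> ht_gens n" for w k
    using that
  proof (induction w)
    case Nil
    have c: "Poly_Mapping.single (Word []) k \<in> carrier (free_ring (ht_gens n))"
      by (auto simp: free_ring_carrier)
    have "gvar g * Poly_Mapping.single (Word []) k = Poly_Mapping.single (Word []) k * gvar g"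
      by (simp add: gvar_def mult_single plus_word_def)
    then show ?case by (simp only: ht_class_simps(1)[OF g c, symmetric] ht_class_simps(1)[OF c g, symmetric])
  next
    case (Cons a w)
    let ?w = "Poly_Mapping.single (Word w) k" and ?g = "ht_class n (gvar g)"
    have a: "a \<in> ht_gens n" "gvar a \<in> carrier (free_ring (ht_gens n))"
      using Cons.prems by (auto intro: free_ring_closed)
    have w: "?w \<in> carrier (free_ring (ht_gens n))" using Cons.prems by (auto simp: free_ring_carrier)
    have "Poly_Mapping.single (Word (a # w)) k = gvar a * ?w"
      by (simp add: gvar_def mult_single plus_word_def)
    then have eq: "ht_class n (Poly_Mapping.single (Word (a # w)) k) = ht_class n (gvar a) \<otimes>\<^bsub>HT n\<^esub> ht_class n ?w"
      using ht_class_simps(1)[OF a(2) w] by simp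
    have "?g \<otimes>\<^bsub>HT n\<^esub> ht_class n (gvar a) = ht_class n (gvar a) \<otimes>\<^bsub>HT n\<^esub> ?g"
      using ht_class_eq_if_rel[OF ht_rel.central[OF assms(1) a(1)]] g a(2) by (simp add: ht_class_simps)
    moreover have "?g \<otimes>\<^bsub>HT n\<^esub> ht_class n ?w = ht_class n ?w \<otimes>\<^bsub>HT n\<^esub> ?g"
      using Cons by auto
    ultimately show ?case
      unfolding eq using ht_class_closed[OF g] ht_class_closed[OF a(2)] ht_class_closed[OF w]
      by (metis HT.m_assoc)
  qed
  show ?thesis unfolding p(2) using p(1)
  proof (induction p rule: free_ring_word_induct)
    case (single w k)
    then show ?case by (rule word)
  next
    case (add p p')
    then show ?case
      using ht_class_closed[OF g] ht_class_closed[of p n] ht_class_closed[of p' n]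
      by (simp add: ht_class_simps HT.l_distr HT.r_distr)
  qed
qed

text \<open>
  The carrier of \<open>HT n\<close> depends on the term \<open>n\<close>, so it is not a type.  To apply the results on type-class
  rings, all \<open>HT n\<close> are collected in one product ring; the factor \<open>int\<close> makes it nontrivial, as
  \<^class>\<open>ring_1\<close> demands.
\<close>

typedef ht_prod = "{p :: int \<times> (nat \<Rightarrow> gen ncpoly set). \<forall>n. snd p n \<in> carrier (HT n)}"
  by (rule exI[of _ "(0, \<lambda>n. \<zero>\<^bsub>HT n\<^esub>)"]) (simp add: ring.ring_simprules(2)[OF HT_ring])

definition int_part :: "ht_prod \<Rightarrow> int" where "int_part a = fst (Rep_ht_prod a)"
definition component :: "nat \<Rightarrow> ht_prod \<Rightarrow> gen ncpoly set" where "component n a = snd (Rep_ht_prod a) n"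
definition make_ht_prod :: "int \<Rightarrow> (nat \<Rightarrow> gen ncpoly set) \<Rightarrow> ht_prod" where "make_ht_prod k f = Abs_ht_prod (k, f)"

lemma component_closed [simp, intro]: "component n a \<in> carrier (HT n)"
  using Rep_ht_prod[of a] by (simp add: component_def)

lemma int_part_make: "(\<And>n. f n \<in> carrier (HT n)) \<Longrightarrow> int_part (make_ht_prod k f) = k"
  and component_make: "(\<And>n. f n \<in> carrier (HT n)) \<Longrightarrow> component m (make_ht_prod k f) = f m"
  by (simp_all add: int_part_def component_def make_ht_prod_def Abs_ht_prod_inverse)

lemma ht_prod_eqI: "int_part a = int_part a' \<Longrightarrow> (\<And>n. component n a = component n a') \<Longrightarrow> a = a'"
  by (auto simp: int_part_def component_def prod_eq_iff simp flip: Rep_ht_prod_inject)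

instantiation ht_prod :: ring_1
begin

definition "0 = make_ht_prod 0 (\<lambda>n. \<zero>\<^bsub>HT n\<^esub>)"
definition "1 = make_ht_prod 1 (\<lambda>n. \<one>\<^bsub>HT n\<^esub>)"
definition "a + a' = make_ht_prod (int_part a + int_part a') (\<lambda>n. component n a \<oplus>\<^bsub>HT n\<^esub> component n a')"
definition "a * a' = make_ht_prod (int_part a * int_part a') (\<lambda>n. component n a \<otimes>\<^bsub>HT n\<^esub> component n a')"
definition "- a = make_ht_prod (- int_part a) (\<lambda>n. \<ominus>\<^bsub>HT n\<^esub> component n a)"
definition "a - a' = make_ht_prod (int_part a - int_part a') (\<lambda>n. component n a \<ominus>\<^bsub>HT n\<^esub> component n a')"

lemma int_part_simps [simp]:
  "int_part 0 = 0" "int_part 1 = 1" "int_part (a + a') = int_part a + int_part a'" "int_part (a * a') = int_part a * int_part a'"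
  "int_part (- a) = - int_part a" "int_part (a - a') = int_part a - int_part a'"
  unfolding zero_ht_prod_def one_ht_prod_def plus_ht_prod_def times_ht_prod_def uminus_ht_prod_def
    minus_ht_prod_def
  by (rule int_part_make; simp add: ring.ring_simprules[OF HT_ring])+

lemma component_simps [simp]:
  "component n 0 = \<zero>\<^bsub>HT n\<^esub>" "component n 1 = \<one>\<^bsub>HT n\<^esub>" "component n (a + a') = component n a \<oplus>\<^bsub>HT n\<^esub> component n a'"
  "component n (a * a') = component n a \<otimes>\<^bsub>HT n\<^esub> component n a'" "component n (- a) = \<ominus>\<^bsub>HT n\<^esub> component n a"
  "component n (a - a') = component n a \<ominus>\<^bsub>HT n\<^esub> component n a'"
  unfolding zero_ht_prod_def one_ht_prod_def plus_ht_prod_def times_ht_prod_def uminus_ht_prod_def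
    minus_ht_prod_def
  by (rule component_make; simp add: ring.ring_simprules[OF HT_ring])+

instance
proof
  fix a a' a'' :: ht_prod
  show "a + a' + a'' = a + (a' + a'')" "a + a' = a' + a" "0 + a = a" "- a + a = 0" "a - a' = a + - a'"
    "a * a' * a'' = a * (a' * a'')" "(a + a') * a'' = a * a'' + a' * a''" "a * (a' + a'') = a * a' + a * a''"
    "1 * a = a" "a * 1 = a"
    by (rule ht_prod_eqI;
        simp add: ring.ring_simprules[OF HT_ring] monoid.r_one[OF ring.is_monoid[OF HT_ring]] algebra_simps)+
  show "(0 :: ht_prod) \<noteq> 1"
    by (metis int_part_simps(1,2) zero_neq_one)
qed

end

lemma component_power: "component n (a ^ k) = component n a [^]\<^bsub>HT n\<^esub> k"
proof -
  interpret HT: ring "HT n" by (rule HT_ring)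
  show ?thesis by (induction k) (simp_all only: power_0 power_Suc2 component_simps HT.nat_pow_0 HT.nat_pow_Suc)
qed

lemma component_of_nat_mult: "component n (of_nat k * a) = add_pow (HT n) k (component n a)"
proof -
  interpret HT: ring "HT n" by (rule HT_ring)
  show ?thesis
  proof (induction k)
    case (Suc k)
    have "component n (of_nat (Suc k) * a) = component n (of_nat k * a) \<oplus>\<^bsub>HT n\<^esub> component n a"
      by (simp add: distrib_right HT.l_distr HT.a_comm)
    then show ?case by (simp only: Suc HT.add.nat_pow_Suc)
  qed simp
qed

lemma component_sum: "finite S \<Longrightarrow> component n (sum F S) = (\<Oplus>\<^bsub>HT n\<^esub>i\<in>S. component n (F i))"
proof -
  interpret HT: ring "HT n" by (rule HT_ring)
  show "finite S \<Longrightarrow> ?thesis" by (induction S rule: finite_induct) simp_all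
qed

lemma component_prod_list: "component n (prod_list xs) = oprod (HT n) (map (component n) xs)"
  by (induction xs) (simp_all add: oprod_def)

text \<open>Additive and multiplicative but not unital: the one of \<open>HT n\<close> goes to a
  central idempotent.\<close>

definition inject :: "nat \<Rightarrow> gen ncpoly set \<Rightarrow> ht_prod"
  where "inject n a = make_ht_prod 0 (\<lambda>m. if m = n then a else \<zero>\<^bsub>HT m\<^esub>)"

lemma inject_simps:
  assumes "a \<in> carrier (HT n)"
  shows "int_part (inject n a) = 0" "component n (inject n a) = a" "m \<noteq> n \<Longrightarrow> component m (inject n a) = \<zero>\<^bsub>HT m\<^esub>"
  using assms unfolding inject_def
  by (subst int_part_make component_make; auto simp: ring.ring_simprules(2)[OF HT_ring])+

lemma ht_prod_eq_at:
  assumes "int_part a = int_part a'" "component n a = component n a'" "\<And>m. m \<noteq> n \<Longrightarrow> component m a = component m a'"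
  shows "a = a'"
  using assms by (metis ht_prod_eqI)


text \<open>
  The generators are placed in the component \<open>n\<close>; in the other components they are \<open>0\<close>, except that the
  inverse \<open>e_of\<close> must be \<open>1\<close> there for the localisation relation to hold.
\<close>

definition beta_of :: "nat \<Rightarrow> ht_prod" where "beta_of n = inject n (ht_beta n)"
definition t_of :: "nat \<Rightarrow> ht_prod" where "t_of n = inject n (ht_t n)"
definition h_of :: "nat \<Rightarrow> nat \<Rightarrow> ht_prod"
  where "h_of n i = (if i \<in> {1..n} then inject n (ht_h n i) else 0)"
definition z_of :: "nat \<Rightarrow> nat \<Rightarrow> ht_prod"
  where "z_of n i = (if i \<in> {1..n} then inject n (ht_z n i) else 0)"
definition q_of :: "nat \<Rightarrow> nat \<Rightarrow> nat \<Rightarrow> ht_prod"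
  where "q_of n i j = (if 1 \<le> i \<and> i < j \<and> j \<le> n then inject n (ht_q n i j) else 0)"
definition u_of :: "nat \<Rightarrow> nat \<Rightarrow> nat \<Rightarrow> ht_prod"
  where "u_of n i j = (if 1 \<le> i \<and> i < j \<and> j \<le> n then inject n (ht_u n i j) else 0)"
definition e_of :: "nat \<Rightarrow> nat \<Rightarrow> nat \<Rightarrow> ht_prod"
  where "e_of n i j = (if 1 \<le> i \<and> i < j \<and> j \<le> n
    then inject n (ht_class n (gvar (GE i j))) + (1 - inject n \<one>\<^bsub>HT n\<^esub>) else 1)"

lemma gvar_closed: "g \<in> ht_gens n \<Longrightarrow> gvar g \<in> carrier (free_ring (ht_gens n))"
  by (rule free_ring_closed)

lemma gen_closed:
  "ht_beta n \<in> carrier (HT n)" "ht_t n \<in> carrier (HT n)"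
  "i \<in> {1..n} \<Longrightarrow> ht_h n i \<in> carrier (HT n)" "i \<in> {1..n} \<Longrightarrow> ht_z n i \<in> carrier (HT n)"
  "1 \<le> i \<Longrightarrow> i < j \<Longrightarrow> j \<le> n \<Longrightarrow> ht_q n i j \<in> carrier (HT n)"
  "1 \<le> i \<Longrightarrow> i < j \<Longrightarrow> j \<le> n \<Longrightarrow> ht_u n i j \<in> carrier (HT n)"
  "1 \<le> i \<Longrightarrow> i < j \<Longrightarrow> j \<le> n \<Longrightarrow> ht_class n (gvar (GE i j)) \<in> carrier (HT n)"
  unfolding ht_beta_def ht_t_def ht_h_def ht_z_def ht_q_def ht_u_def
  by (auto intro!: ht_class_closed gvar_closed ht_gens_mem(2-) hpar_closed)

lemma gen_simps:
  "int_part (beta_of n) = 0" "int_part (t_of n) = 0" "int_part (h_of n i) = 0" "int_part (z_of n i) = 0" "int_part (q_of n i j) = 0"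
  "int_part (u_of n i j) = 0" "int_part (e_of n i j) = 1"
  "component n (beta_of n) = ht_beta n" "component n (t_of n) = ht_t n"
  "i \<in> {1..n} \<Longrightarrow> component n (h_of n i) = ht_h n i" "i \<in> {1..n} \<Longrightarrow> component n (z_of n i) = ht_z n i"
  "1 \<le> i \<Longrightarrow> i < j \<Longrightarrow> j \<le> n \<Longrightarrow> component n (q_of n i j) = ht_q n i j"
  "1 \<le> i \<Longrightarrow> i < j \<Longrightarrow> j \<le> n \<Longrightarrow> component n (u_of n i j) = ht_u n i j"
  "1 \<le> i \<Longrightarrow> i < j \<Longrightarrow> j \<le> n \<Longrightarrow> component n (e_of n i j) = ht_class n (gvar (GE i j))"
  unfolding beta_of_def t_of_def h_of_def z_of_def q_of_def u_of_def e_of_def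
  by (simp_all add: inject_simps gen_closed ring.ring_simprules[OF HT_ring] a_minus_def)

lemma gen_simps_other:
  assumes "m \<noteq> n"
  shows "component m (beta_of n) = \<zero>\<^bsub>HT m\<^esub>" "component m (t_of n) = \<zero>\<^bsub>HT m\<^esub>" "component m (h_of n i) = \<zero>\<^bsub>HT m\<^esub>"
  "component m (z_of n i) = \<zero>\<^bsub>HT m\<^esub>" "component m (q_of n i j) = \<zero>\<^bsub>HT m\<^esub>" "component m (u_of n i j) = \<zero>\<^bsub>HT m\<^esub>"
  "component m (e_of n i j) = \<one>\<^bsub>HT m\<^esub>"
  using assms unfolding beta_of_def t_of_def h_of_def z_of_def q_of_def u_of_def e_of_def
  by (simp_all add: inject_simps gen_closed ring.ring_simprules[OF HT_ring] a_minus_def)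

lemma coeff_gen_central:
  assumes "y \<in> carrier (HT n)"
  shows "ht_beta n \<otimes>\<^bsub>HT n\<^esub> y = y \<otimes>\<^bsub>HT n\<^esub> ht_beta n" "ht_t n \<otimes>\<^bsub>HT n\<^esub> y = y \<otimes>\<^bsub>HT n\<^esub> ht_t n"
  "i \<in> {1..n} \<Longrightarrow> ht_h n i \<otimes>\<^bsub>HT n\<^esub> y = y \<otimes>\<^bsub>HT n\<^esub> ht_h n i"
  "1 \<le> i \<Longrightarrow> i < j \<Longrightarrow> j \<le> n \<Longrightarrow> ht_q n i j \<otimes>\<^bsub>HT n\<^esub> y = y \<otimes>\<^bsub>HT n\<^esub> ht_q n i j"
  "1 \<le> i \<Longrightarrow> i < j \<Longrightarrow> j \<le> n \<Longrightarrow>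
    ht_class n (gvar (GE i j)) \<otimes>\<^bsub>HT n\<^esub> y = y \<otimes>\<^bsub>HT n\<^esub> ht_class n (gvar (GE i j))"
proof -
  interpret HT: ring "HT n" by (rule HT_ring)
  show "ht_beta n \<otimes>\<^bsub>HT n\<^esub> y = y \<otimes>\<^bsub>HT n\<^esub> ht_beta n" "ht_t n \<otimes>\<^bsub>HT n\<^esub> y = y \<otimes>\<^bsub>HT n\<^esub> ht_t n"
    unfolding ht_beta_def ht_t_def using assms by (auto intro!: coeff_central simp: coeff_gens_def)
  show "ht_h n i \<otimes>\<^bsub>HT n\<^esub> y = y \<otimes>\<^bsub>HT n\<^esub> ht_h n i" if "i \<in> {1..n}"
  proof (cases "i = 1")
    case True
    then show ?thesis using assms by (simp add: ht_h_def hpar_def ht_class_zero)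
  next
    case False
    then show ?thesis unfolding ht_h_def hpar_def using assms that
      by (auto intro!: coeff_central simp: coeff_gens_def)
  qed
  show "ht_q n i j \<otimes>\<^bsub>HT n\<^esub> y = y \<otimes>\<^bsub>HT n\<^esub> ht_q n i j"
    "ht_class n (gvar (GE i j)) \<otimes>\<^bsub>HT n\<^esub> y = y \<otimes>\<^bsub>HT n\<^esub> ht_class n (gvar (GE i j))"
    if "1 \<le> i" "i < j" "j \<le> n"
    unfolding ht_q_def using assms that by (auto intro!: coeff_central simp: coeff_gens_def)
qed

lemma class_gens: "ht_class n (gvar GBeta) = ht_beta n" "ht_class n (gvar GT) = ht_t n"
  "ht_class n (hpar i) = ht_h n i" "ht_class n (gvar (GQ i j)) = ht_q n i j"
  "ht_class n (gvar (GU i j)) = ht_u n i j" "ht_class n (gvar (GZ i)) = ht_z n i"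
  by (simp_all add: ht_beta_def ht_t_def ht_h_def ht_q_def ht_u_def ht_z_def)

lemmas class_rel_simps =
  ht_class_simps class_gens free_ring_closed gvar_closed ht_gens_mem hpar_closed power2_eq_square ht_class_one

lemma HT_relations:
  shows "1 \<le> i \<Longrightarrow> i < j \<Longrightarrow> j \<le> n \<Longrightarrow>
      (\<one>\<^bsub>HT n\<^esub> \<oplus>\<^bsub>HT n\<^esub> ht_beta n \<otimes>\<^bsub>HT n\<^esub> ht_t n \<ominus>\<^bsub>HT n\<^esub> ht_t n \<otimes>\<^bsub>HT n\<^esub> ht_t n \<otimes>\<^bsub>HT n\<^esub> ht_q n i j)
        \<otimes>\<^bsub>HT n\<^esub> ht_class n (gvar (GE i j)) = \<one>\<^bsub>HT n\<^esub>"
    and "i \<in> {1..n} \<Longrightarrow> j \<in> {1..n} \<Longrightarrow> ht_z n i \<otimes>\<^bsub>HT n\<^esub> ht_z n j = ht_z n j \<otimes>\<^bsub>HT n\<^esub> ht_z n i"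
    and "1 \<le> i \<Longrightarrow> i < j \<Longrightarrow> j \<le> n \<Longrightarrow> 1 \<le> k \<Longrightarrow> k < l \<Longrightarrow> l \<le> n \<Longrightarrow> {i, j} \<inter> {k, l} = {} \<Longrightarrow>
      ht_u n i j \<otimes>\<^bsub>HT n\<^esub> ht_u n k l = ht_u n k l \<otimes>\<^bsub>HT n\<^esub> ht_u n i j"
    and "1 \<le> i \<Longrightarrow> i < j \<Longrightarrow> j < k \<Longrightarrow> k \<le> n \<Longrightarrow> ht_u n i j \<otimes>\<^bsub>HT n\<^esub> ht_u n j k
      = ht_u n i k \<otimes>\<^bsub>HT n\<^esub> ht_u n i j \<oplus>\<^bsub>HT n\<^esub> ht_u n j k \<otimes>\<^bsub>HT n\<^esub> ht_u n i k
        \<ominus>\<^bsub>HT n\<^esub> ht_beta n \<otimes>\<^bsub>HT n\<^esub> ht_u n i k"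
    and "1 \<le> i \<Longrightarrow> i < j \<Longrightarrow> j < k \<Longrightarrow> k \<le> n \<Longrightarrow> ht_u n j k \<otimes>\<^bsub>HT n\<^esub> ht_u n i j
      = ht_u n i j \<otimes>\<^bsub>HT n\<^esub> ht_u n i k \<oplus>\<^bsub>HT n\<^esub> ht_u n i k \<otimes>\<^bsub>HT n\<^esub> ht_u n j k
        \<ominus>\<^bsub>HT n\<^esub> ht_beta n \<otimes>\<^bsub>HT n\<^esub> ht_u n i k"
    and "1 \<le> i \<Longrightarrow> i < j \<Longrightarrow> j \<le> n \<Longrightarrow>
      ht_u n i j \<otimes>\<^bsub>HT n\<^esub> ht_u n i j \<ominus>\<^bsub>HT n\<^esub> ht_beta n \<otimes>\<^bsub>HT n\<^esub> ht_u n i j = ht_q n i j"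
    and "i \<in> {1..n} \<Longrightarrow> 1 \<le> k \<Longrightarrow> k < l \<Longrightarrow> l \<le> n \<Longrightarrow> i \<notin> {k, l} \<Longrightarrow>
      ht_z n i \<otimes>\<^bsub>HT n\<^esub> ht_u n k l = ht_u n k l \<otimes>\<^bsub>HT n\<^esub> ht_z n i"
    and "1 \<le> i \<Longrightarrow> i < j \<Longrightarrow> j \<le> n \<Longrightarrow> ht_z n i \<otimes>\<^bsub>HT n\<^esub> ht_u n i j
      = ht_u n i j \<otimes>\<^bsub>HT n\<^esub> ht_z n j \<oplus>\<^bsub>HT n\<^esub> ht_beta n \<otimes>\<^bsub>HT n\<^esub> ht_z n i \<oplus>\<^bsub>HT n\<^esub> ht_h n j"
    and "1 \<le> i \<Longrightarrow> i < j \<Longrightarrow> j \<le> n \<Longrightarrow> ht_z n j \<otimes>\<^bsub>HT n\<^esub> ht_u n i j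
      = ht_u n i j \<otimes>\<^bsub>HT n\<^esub> ht_z n i \<ominus>\<^bsub>HT n\<^esub> ht_beta n \<otimes>\<^bsub>HT n\<^esub> ht_z n i \<ominus>\<^bsub>HT n\<^esub> ht_h n j"
  subgoal using ht_class_eq_if_rel[OF ht_rel.localisation[of i j n]] by (simp add: class_rel_simps)
  subgoal using ht_class_eq_if_rel[OF ht_rel.z_z[of i n j]] by (simp add: class_rel_simps)
  subgoal using ht_class_eq_if_rel[OF ht_rel.u_u[of i j n k l]] by (simp add: class_rel_simps)
  subgoal using ht_class_eq_if_rel[OF ht_rel.three_term1[of i j k n]] by (simp add: class_rel_simps)
  subgoal using ht_class_eq_if_rel[OF ht_rel.three_term2[of i j k n]] by (simp add: class_rel_simps)
  subgoal using ht_class_eq_if_rel[OF ht_rel.quadratic[of i j n]] by (simp add: class_rel_simps)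
  subgoal using ht_class_eq_if_rel[OF ht_rel.z_u[of i n k l]] by (simp add: class_rel_simps)
  subgoal using ht_class_eq_if_rel[OF ht_rel.z_u_left[of i j n]] by (simp add: class_rel_simps)
  subgoal using ht_class_eq_if_rel[OF ht_rel.z_u_right[of i j n]] by (simp add: class_rel_simps)
  done

lemmas at_n = gen_simps coeff_gen_central HT_relations
lemmas off_n = gen_simps_other ring.ring_simprules[OF HT_ring] monoid.r_one[OF ring.is_monoid[OF HT_ring]]
  a_minus_def

text \<open>Every axiom is checked by components: component \<open>n\<close> is a relation of
  \<open>HT n\<close>, and the others hold by the values 0 and 1 chosen there.\<close>

interpretation HTn: ht_presentation n "beta_of n" "t_of n" "h_of n" "z_of n" "q_of n" "e_of n" "u_of n" for n
proof
  show "beta_of n * y = y * beta_of n" "t_of n * y = y * t_of n" for y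
    by (rule ht_prod_eq_at[of _ _ n]; simp add: at_n off_n)+
  show "h_of n i * y = y * h_of n i" for i y
  proof (cases "i \<in> {1..n}")
    case True
    then show ?thesis by (intro ht_prod_eq_at[of _ _ n]) (simp_all add: at_n off_n)
  qed (simp only: h_of_def if_False mult_zero_left mult_zero_right)
  show "q_of n i j * y = y * q_of n i j" for i j y
  proof (cases "1 \<le> i \<and> i < j \<and> j \<le> n")
    case True
    then show ?thesis by (intro ht_prod_eq_at[of _ _ n]) (simp_all add: at_n off_n)
  qed (simp only: q_of_def if_False mult_zero_left mult_zero_right)
  show "e_of n i j * y = y * e_of n i j" for i j y
  proof (cases "1 \<le> i \<and> i < j \<and> j \<le> n")
    case True
    then show ?thesis by (intro ht_prod_eq_at[of _ _ n]) (simp_all add: at_n off_n)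
  qed (simp only: e_of_def if_False mult_1_left mult_1_right)
  \<comment> \<open>The presentation has \<open>\<beta> t\<close> where the locale has
    \<open>t \<beta>\<close>; centrality mediates.\<close>
  show "(1 + t_of n * beta_of n - t_of n ^ 2 * q_of n i j) * e_of n i j = 1" if "1 \<le> i" "i < j" "j \<le> n" for i j
    using HT_relations(1)[OF that] that
    by (intro ht_prod_eq_at[of _ _ n])
      (simp_all add: gen_simps coeff_gen_central(1)[OF gen_closed(2)] off_n power2_eq_square)
  show "z_of n i * z_of n j = z_of n j * z_of n i" if "i \<in> {1..n}" "j \<in> {1..n}" for i j
    using that by (intro ht_prod_eq_at[of _ _ n]) (simp_all add: at_n off_n)
  show "u_of n i j * u_of n k l = u_of n k l * u_of n i j"
    if "1 \<le> i" "i < j" "j \<le> n" "1 \<le> k" "k < l" "l \<le> n" "{i, j} \<inter> {k, l} = {}" for i j k l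
    using HT_relations(3)[OF that] that by (intro ht_prod_eq_at[of _ _ n]) (simp_all add: gen_simps off_n)
  show "u_of n i j * u_of n j k = u_of n i k * u_of n i j + u_of n j k * u_of n i k - beta_of n * u_of n i k"
    if "1 \<le> i" "i < j" "j < k" "k \<le> n" for i j k
    using HT_relations(4)[OF that] that by (intro ht_prod_eq_at[of _ _ n]) (simp_all add: gen_simps off_n)
  show "u_of n j k * u_of n i j = u_of n i j * u_of n i k + u_of n i k * u_of n j k - beta_of n * u_of n i k"
    if "1 \<le> i" "i < j" "j < k" "k \<le> n" for i j k
    using HT_relations(5)[OF that] that by (intro ht_prod_eq_at[of _ _ n]) (simp_all add: gen_simps off_n)
  show "(u_of n i j)^2 - beta_of n * u_of n i j = q_of n i j" if "1 \<le> i" "i < j" "j \<le> n" for i j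
    using HT_relations(6)[OF that] that
    by (intro ht_prod_eq_at[of _ _ n]) (simp_all add: gen_simps off_n power2_eq_square)
  show "z_of n i * u_of n k l = u_of n k l * z_of n i"
    if "i \<in> {1..n}" "1 \<le> k" "k < l" "l \<le> n" "i \<notin> {k, l}" for i k l
    using HT_relations(7)[OF that] that by (intro ht_prod_eq_at[of _ _ n]) (simp_all add: gen_simps off_n)
  show "z_of n i * u_of n i j = u_of n i j * z_of n j + beta_of n * z_of n i + h_of n j"
    if "1 \<le> i" "i < j" "j \<le> n" for i j
    using HT_relations(8)[OF that] that by (intro ht_prod_eq_at[of _ _ n]) (simp_all add: gen_simps off_n)
  show "z_of n j * u_of n i j = u_of n i j * z_of n i - beta_of n * z_of n i - h_of n j"
    if "1 \<le> i" "i < j" "j \<le> n" for i j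
    using HT_relations(9)[OF that] that by (intro ht_prod_eq_at[of _ _ n]) (simp_all add: gen_simps off_n)
qed

section \<open>Reading the identity in one component\<close>

text \<open>The component of \<open>h_inv\<close> is a two-sided inverse, and such an inverse is
  unique.\<close>

lemma component_h:
  assumes "1 \<le> i" "i < j" "j \<le> n"
  shows "component n (HTn.h n i j) = h_elt n i j" "inv\<^bsub>HT n\<^esub> h_elt n i j = component n (HTn.h_inv n i j)"
proof -
  interpret HT: ring "HT n" by (rule HT_ring)
  show h: "component n (HTn.h n i j) = h_elt n i j"
    using assms by (simp add: HTn.h_def h_elt_def gen_simps)
  have "component n (HTn.h n i j) \<otimes>\<^bsub>HT n\<^esub> component n (HTn.h_inv n i j) = \<one>\<^bsub>HT n\<^esub>"
    "component n (HTn.h_inv n i j) \<otimes>\<^bsub>HT n\<^esub> component n (HTn.h n i j) = \<one>\<^bsub>HT n\<^esub>"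
    unfolding component_simps(4)[symmetric] HTn.h_inv[OF assms] by (rule component_simps(2))+
  then show "inv\<^bsub>HT n\<^esub> h_elt n i j = component n (HTn.h_inv n i j)"
    unfolding h[symmetric] by (intro HT.inv_char component_closed)
qed

lemma component_dunkl_elt:
  assumes "i \<in> {1..n}"
  shows "component n (HTn.dunkl_elt n (HTn.x n) n i) = dunkl n i"
proof -
  have "map (component n) (map (\<lambda>j. HTn.h_inv n j i) (rev [1..<i])) = map (\<lambda>j. inv\<^bsub>HT n\<^esub> h_elt n j i) (rev [1..<i])"
    using assms by (auto simp: component_h(2))
  moreover have "map (component n) (map (HTn.h n i) (rev [Suc i..<Suc n])) = map (h_elt n i) (rev [Suc i..<Suc n])"
    using assms by (auto simp: component_h(1) simp del: upt_Suc)
  moreover have "{i<..n} = {Suc i..<Suc n}" by auto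
  moreover have "component n (HTn.x n i) = \<one>\<^bsub>HT n\<^esub> \<oplus>\<^bsub>HT n\<^esub> ht_z n i"
    using assms by (simp add: HTn.x_def gen_simps)
  ultimately show ?thesis
    unfolding HTn.dunkl_elt_def HTn.dn_def HTn.dn_inv_def dunkl_def
    by (simp only: component_simps component_prod_list sorted_list_of_set_range)
qed

lemma component_c:
  assumes "1 \<le> i" "i < j" "j \<le> n"
  shows "component n (HTn.c n i j) = \<one>\<^bsub>HT n\<^esub> \<oplus>\<^bsub>HT n\<^esub> ht_t n \<otimes>\<^bsub>HT n\<^esub> ht_beta n
    \<ominus>\<^bsub>HT n\<^esub> ht_t n [^]\<^bsub>HT n\<^esub> (2::nat) \<otimes>\<^bsub>HT n\<^esub> ht_q n i j"
  using assms by (simp only: HTn.c_def component_simps component_power gen_simps)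

lemma component_s: "component n (HTn.s n) = \<one>\<^bsub>HT n\<^esub> \<oplus>\<^bsub>HT n\<^esub> ht_t n \<otimes>\<^bsub>HT n\<^esub> ht_beta n"
  by (simp add: HTn.s_def gen_simps)

lemma component_shift:
  "component n (\<Sum>r\<in>{1..m}. of_nat (m choose r) * (t_of n ^ r * beta_of n ^ (r - 1))) = shift_poly n m"
  unfolding shift_poly_def
  unfolding component_sum[OF finite_atLeastAtMost] component_of_nat_mult
  by (simp only: component_simps component_power gen_simps)

lemma component_factor:
  assumes "i \<in> {1..n}"
  shows "component n (HTn.factor n i m) = ht_z n i \<otimes>\<^bsub>HT n\<^esub> (\<one>\<^bsub>HT n\<^esub> \<oplus>\<^bsub>HT n\<^esub> ht_t n \<otimes>\<^bsub>HT n\<^esub> ht_beta n) [^]\<^bsub>HT n\<^esub> m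
    \<oplus>\<^bsub>HT n\<^esub> \<one>\<^bsub>HT n\<^esub> \<oplus>\<^bsub>HT n\<^esub> ht_h n i \<otimes>\<^bsub>HT n\<^esub> shift_poly n m"
  unfolding HTn.factor_eq using assms by (simp only: component_simps component_power component_shift component_s gen_simps)

text \<open>Identifies the double comprehension of the theorem with a mapped list of pairs, the form
  that \<open>sum_dunkl_elt\<close> takes.\<close>

lemma comprehension_product:
  "[f i j. i \<leftarrow> xs, j \<leftarrow> ys, P i j] = map (\<lambda>(i, j). f i j) (filter (\<lambda>(i, j). P i j) (List.product xs ys))"
proof -
  have "concat (map (\<lambda>j. if P i j then [f i j] else []) ys) = map (\<lambda>(i, j). f i j) (filter (\<lambda>(i, j). P i j) (map (Pair i) ys))" for i
    by (induction ys) simp_all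
  then show ?thesis by (induction xs) simp_all
qed

theorem theorem3p4:
  fixes n k :: nat and A (structure)
  assumes "A = HT n" and "n \<ge> 2" and "1 \<le> k" and "k \<le> n"
  shows
    "(\<Oplus>I\<in>{I. I \<subseteq> {1..n} \<and> card I = k}.
        dunkl_prod n I \<otimes>
        oprod A [\<one> \<oplus> ht_t n \<otimes> ht_beta n \<ominus> ht_t n [^] (2::nat) \<otimes> ht_q n i j.
                  i \<leftarrow> [1..<Suc n], j \<leftarrow> [1..<Suc n], i \<notin> I \<and> j \<in> I \<and> i < j])
     = (\<Oplus>i\<in>{i :: nat list. length i = k \<and> set i \<subseteq> {1..n} \<and> sorted_wrt (<) i}.
        oprod A (map (\<lambda>a. let i\<^sub>a = i ! (a - 1) in
            (\<one> \<oplus> ht_t n \<otimes> ht_beta n) [^] (n + a - (k + i\<^sub>a)) \<otimes>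
            (ht_z n i\<^sub>a \<otimes> (\<one> \<oplus> ht_t n \<otimes> ht_beta n) [^] (i\<^sub>a - a) \<oplus> \<one>
              \<oplus> ht_h n i\<^sub>a \<otimes> shift_poly n (i\<^sub>a - a)))
          [1..<Suc k]))"
    (is "(\<Oplus>I\<in>_. ?L I) = (\<Oplus>i\<in>_. ?R i)")
proof -
  interpret HT: ring A unfolding assms(1) by (rule HT_ring)
  define L where "L I = filter (\<lambda>(i, j). i \<notin> I \<and> j \<in> I \<and> i < j) (List.product [1..<Suc n] [1..<Suc n])" for I
  let ?l = "\<lambda>I. prod_list (map (HTn.dunkl_elt n (HTn.x n) n) (sorted_list_of_set I)) * prod_list (map (\<lambda>(i, j). HTn.c n i j) (L I))"
  let ?r = "HTn.list_term n n k"
  have L: "distinct (L I)" "set (L I) = {(i, j). 1 \<le> i \<and> i < j \<and> j \<le> n \<and> i \<notin> I \<and> j \<in> I}" for I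
    by (auto simp: L_def distinct_product simp del: upt_Suc)
  have l: "component n (?l I) = ?L I" if "I \<in> ksubsets n k" for I
  proof -
    have I: "finite I" "I \<subseteq> {1..n}" using that by (auto intro: finite_subset)
    have "map (component n) (map (HTn.dunkl_elt n (HTn.x n) n) (sorted_list_of_set I)) = map (dunkl n) (sorted_list_of_set I)"
      using I by (auto intro!: component_dunkl_elt)
    moreover have "map (component n) (map (\<lambda>(i, j). HTn.c n i j) (L I)) = map (\<lambda>(i, j). \<one> \<oplus> ht_t n \<otimes> ht_beta n \<ominus> ht_t n [^] (2::nat) \<otimes> ht_q n i j) (L I)"
      unfolding assms(1) using L(2)[of I] by (auto simp: component_c)
    ultimately show ?thesis
      unfolding comprehension_product L_def[symmetric] assms(1) dunkl_prod_def
      by (simp only: component_simps component_prod_list)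
  qed
  have r: "component n (?r i) = ?R i" if "i \<in> increasing_lists n k" for i
  proof -
    have "i ! (a - 1) \<in> {1..n}" if "a \<in> set [1..<Suc k]" for a
    proof -
      have "i ! (a - 1) \<in> set i" using that \<open>i \<in> increasing_lists n k\<close> by (intro nth_mem) auto
      then show ?thesis using \<open>i \<in> increasing_lists n k\<close> by auto
    qed
    then show ?thesis
      unfolding HTn.list_term_def component_prod_list map_map Let_def assms(1)
      by (intro arg_cong[of _ _ "oprod _"] map_cong refl)
        (simp only: o_def component_simps component_power component_s component_factor)
  qed
  \<comment> \<open>The identity is proved in the product ring and carried to \<open>HT n\<close> by
    the projection \<open>component n\<close>.\<close>
  have "(\<Oplus>I\<in>ksubsets n k. ?L I) = (\<Oplus>I\<in>ksubsets n k. component n (?l I))"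
    by (rule HT.finsum_cong'[OF refl _ l[symmetric]]) (simp only: assms(1), rule Pi_I, rule component_closed)
  also have "\<dots> = component n (\<Sum>I\<in>ksubsets n k. ?l I)"
    unfolding assms(1) by (rule component_sum[OF finite_ksubsets, symmetric])
  also have "(\<Sum>I\<in>ksubsets n k. ?l I) = (\<Sum>i\<in>increasing_lists n k. ?r i)"
    by (rule HTn.sum_dunkl_elt[OF L])
  also have "component n \<dots> = (\<Oplus>i\<in>increasing_lists n k. component n (?r i))"
    unfolding assms(1) by (rule component_sum[OF finite_increasing_lists])
  also have "\<dots> = (\<Oplus>i\<in>increasing_lists n k. ?R i)"
    by (rule HT.finsum_cong'[OF refl _ r[symmetric], symmetric]) (simp only: assms(1), rule Pi_I, rule component_closed)
  finally show ?thesis .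
qed

end
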